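(* Let the iterates $\boldsymbol{x}_1,\dots,\boldsymbol{x}_{T+1}$ be produced by the General Proximal Gradient Method and suppose the following three conditions hold: 1. The index $\mathsf{i}(t)$ is uniformly distributed on $[n]$ for every $t\in[T]$ (the indices may be dependent). 2. The stepsize $\eta_t$, $t\in[T]$, is non-increasing. 3. $|\mathbb{E}[\Omega_t(\boldsymbol{x}_s)]|\le\Phi\eta_s$ for all $t\in[T]$, $s\in[t]$, where $\Omega_t(\cdot)=f_{\mathsf{i}(t)}(\cdot)-f(\cdot)$ and $\Phi\ge0$ is a constant possibly depending on $T$, $n$, $\mu$, and $G_1,\dots,G_n$. Then for any $\boldsymbol{z}\in\mathbb{R}^d$, $$\mathbb{E}[F(\boldsymbol{x}_{T+1})-F(\boldsymbol{z})]\le O\left(\frac{\|\boldsymbol{z}-\boldsymbol{x}_1\|^2}{\sum_{t=1}^T\gamma_t\eta_t}+\left(G_{f,2}^2+\Phi\right)\sum_{t=1}^T\frac{\gamma_t\eta_t^2}{\sum_{s=t}^T\gamma_s\eta_s}\right),$$ where $\gamma_t=\prod_{s=1}^{t-1}(1+\mu\eta_s)$ for $t\in[T+1]$.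
   Context: Notation: $\mathbb{N}=\{1,2,\dots\}$, $[m]=\{1,\dots,m\}$, $\|\cdot\|$ and $\langle\cdot,\cdot\rangle$ are the Euclidean norm and inner product on $\mathbb{R}^d$, $\overline{\mathbb{R}}=(-\infty,+\infty]$, $\mathrm{dom}\,h=\{\boldsymbol{x}:h(\boldsymbol{x})<+\infty\}$, $\partial h(\boldsymbol{x})$ is the convex subdifferential and $\nabla h(\boldsymbol{x})$ denotes an element of $\partial h(\boldsymbol{x})$. $O(\cdot)$ hides an absolute constant. Empty products are $1$. Problem: $F=f+\psi$ with $f=\frac1n\sum_{i=1}^n f_i$, each $f_i:\mathbb{R}^d\to\mathbb{R}$ convex, and $\psi:\mathbb{R}^d\to\overline{\mathbb{R}}$ proper, closed and convex. $\mu\ge0$ is such that $\psi(\boldsymbol{x})-\psi(\boldsymbol{y})-\langle\nabla\psi(\boldsymbol{y}),\boldsymbol{x}-\boldsymbol{y}\rangle\ge\frac\mu2\|\boldsymbol{x}-\boldsymbol{y}\|^2$ for all $\boldsymbol{x}\in\mathbb{R}^d$, $\boldsymbol{y}\in\mathrm{dom}\,\psi$ with $\partial\psi(\boldsymbol{y})\neq\varnothing$, and $\nabla\psi(\boldsymbol{y})\in\partial\psi(\boldsymbol{y})$. Each $f_i$ is $G_i$-Lipschitz on $\mathrm{dom}\,\psi$ for some $G_i>0$. Put $G_{f,2}=\sqrt{\frac1n\sum_{i=1}^nG_i^2}$. General Proximal Gradient Method: given $T\in\mathbb{N}$, an initial point $\boldsymbol{x}_1\in\mathrm{dom}\,\psi$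 and stepsizes $\eta_t>0$, $t\in[T]$, for $t=1,\dots,T$ generate an index $\mathsf{i}(t)\in[n]$ and set $$\boldsymbol{x}_{t+1}=\mathrm{argmin}_{\boldsymbol{x}\in\mathbb{R}^d}\ \psi(\boldsymbol{x})+\langle\nabla f_{\mathsf{i}(t)}(\boldsymbol{x}_t),\boldsymbol{x}\rangle+\frac{\|\boldsymbol{x}-\boldsymbol{x}_t\|^2}{2\eta_t}.$$
   Formalization: Lipschitz on dom ψ is taken to include that the subgradients used have norm at most G_i (otherwise false when they are large at boundary points of dom ψ); the absolute constant is stated per underlying set of outcomes, the real line serving for all. *)

theory Defs
  imports "HOL-Probability.Probability"
begin

text \<open>
  The absolute constant hidden by \<open>O(\<cdot>)\<close> must not depend on the dimension, so the dimension has to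
  be quantified inside the formula. Hence a vector of \<open>\<real>\<^sup>d\<close> is a function \<open>x :: nat \<Rightarrow> real\<close>
  with \<open>x i = 0\<close> for \<open>i \<ge> d\<close>, that is, a point of the library space \<^const>\<open>Euclidean_space\<close>.
  A function on \<open>\<real>\<^sup>d\<close> is a function on \<open>nat \<Rightarrow> real\<close> of which only the values on \<open>Rd d\<close> matter.
\<close>

definition Rd :: "nat \<Rightarrow> (nat \<Rightarrow> real) set" where
  "Rd d = topspace (Euclidean_space d)"

definition vinner :: "nat \<Rightarrow> (nat \<Rightarrow> real) \<Rightarrow> (nat \<Rightarrow> real) \<Rightarrow> real" where
  "vinner d x y = (\<Sum>i<d. x i * y i)"

definition vnorm :: "nat \<Rightarrow> (nat \<Rightarrow> real) \<Rightarrow> real" where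
  "vnorm d x = sqrt (vinner d x x)"

definition vdiff :: "(nat \<Rightarrow> real) \<Rightarrow> (nat \<Rightarrow> real) \<Rightarrow> nat \<Rightarrow> real" where
  "vdiff x y = (\<lambda>i. x i - y i)"

definition eff_dom :: "nat \<Rightarrow> ((nat \<Rightarrow> real) \<Rightarrow> ereal) \<Rightarrow> (nat \<Rightarrow> real) set" where
  "eff_dom d h = {x \<in> Rd d. h x < \<infinity>}"

definition proper_fun :: "nat \<Rightarrow> ((nat \<Rightarrow> real) \<Rightarrow> ereal) \<Rightarrow> bool" where
  "proper_fun d h \<longleftrightarrow> (\<forall>x\<in>Rd d. h x \<noteq> -\<infinity>) \<and> eff_dom d h \<noteq> {}"

definition closed_fun :: "nat \<Rightarrow> ((nat \<Rightarrow> real) \<Rightarrow> ereal) \<Rightarrow> bool" where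
  "closed_fun d h \<longleftrightarrow>
     closedin (prod_topology (Euclidean_space d) euclideanreal) {(x, r). x \<in> Rd d \<and> h x \<le> ereal r}"

text \<open>Since \<open>0 * \<infinity> = 0\<close> in \<^typ>\<open>ereal\<close>, the cases \<open>u = 0\<close> and \<open>u = 1\<close> impose nothing.\<close>

definition convex_fun :: "nat \<Rightarrow> ((nat \<Rightarrow> real) \<Rightarrow> ereal) \<Rightarrow> bool" where
  "convex_fun d h \<longleftrightarrow>
     (\<forall>x\<in>Rd d. \<forall>y\<in>Rd d. \<forall>u\<in>{0..1::real}.
        h (\<lambda>i. u * x i + (1 - u) * y i) \<le> ereal u * h x + ereal (1 - u) * h y)"

definition subdifferential ::
  "nat \<Rightarrow> ((nat \<Rightarrow> real) \<Rightarrow> ereal) \<Rightarrow> (nat \<Rightarrow> real) \<Rightarrow> (nat \<Rightarrow> real) set" where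
  "subdifferential d h x =
     {g \<in> Rd d. \<forall>y\<in>Rd d. h x + ereal (vinner d g (vdiff y x)) \<le> h y}"

definition favg :: "nat \<Rightarrow> (nat \<Rightarrow> (nat \<Rightarrow> real) \<Rightarrow> real) \<Rightarrow> (nat \<Rightarrow> real) \<Rightarrow> real" where
  "favg n f x = (\<Sum>i=1..n. f i x) / real n"

definition Fobj ::
  "nat \<Rightarrow> (nat \<Rightarrow> (nat \<Rightarrow> real) \<Rightarrow> real) \<Rightarrow> ((nat \<Rightarrow> real) \<Rightarrow> ereal) \<Rightarrow> (nat \<Rightarrow> real) \<Rightarrow> ereal" where
  "Fobj n f \<psi> x = ereal (favg n f x) + \<psi> x"

definition composite_problem ::
  "nat \<Rightarrow> nat \<Rightarrow> (nat \<Rightarrow> (nat \<Rightarrow> real) \<Rightarrow> real) \<Rightarrow> ((nat \<Rightarrow> real) \<Rightarrow> ereal) \<Rightarrow> real \<Rightarrow> (nat \<Rightarrow> real) \<Rightarrow> bool"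
where
  "composite_problem d n f \<psi> \<mu> G \<longleftrightarrow>
     1 \<le> d \<and> 1 \<le> n \<and>
     (\<forall>i\<in>{1..n}. convex_fun d (\<lambda>x. ereal (f i x))) \<and>
     proper_fun d \<psi> \<and> closed_fun d \<psi> \<and> convex_fun d \<psi> \<and>
     0 \<le> \<mu> \<and>
     (\<forall>x\<in>Rd d. \<forall>y\<in>eff_dom d \<psi>. \<forall>g\<in>subdifferential d \<psi> y.
        \<psi> x - \<psi> y - ereal (vinner d g (vdiff x y)) \<ge> ereal (\<mu> / 2 * (vnorm d (vdiff x y))\<^sup>2)) \<and>
     (\<forall>i\<in>{1..n}. 0 < G i \<and>
        (\<forall>x\<in>eff_dom d \<psi>. \<forall>y\<in>eff_dom d \<psi>. \<bar>f i x - f i y\<bar> \<le> G i * vnorm d (vdiff x y)))"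

text \<open>
  The vector \<open>g t \<omega>\<close> is the chosen element \<open>\<nabla>f\<^sub>i(x\<^sub>t)\<close> of the subdifferential for \<open>i = idx t \<omega>\<close>; the
  choice may vary with \<open>t\<close> and \<open>\<omega>\<close>. That \<open>f\<^sub>i\<close> is \<open>G\<^sub>i\<close>-Lipschitz on \<open>dom \<psi>\<close> is understood, as usual
  for subgradient methods, to include the bound \<open>G\<^sub>i\<close> on the subgradients taken there, which the
  inequality between function values does not imply at points that are not interior to \<open>dom \<psi>\<close>.
  (For \<open>f(x) = max(0, -2x)\<close> and \<open>\<psi>(x) = x\<close> on \<open>[0,1]\<close>, one step of size \<open>1\<close> from \<open>0\<close> with the
  subgradient \<open>-2\<close> ends in \<open>1\<close> and raises \<open>f + \<psi>\<close> by \<open>1\<close>, although \<open>f\<close> is constant on \<open>[0,1]\<close>.)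
  The bound is required only of the subgradients that are used.
\<close>

definition prox_gradient_run ::
  "'w measure \<Rightarrow> nat \<Rightarrow> nat \<Rightarrow> (nat \<Rightarrow> (nat \<Rightarrow> real) \<Rightarrow> real) \<Rightarrow> ((nat \<Rightarrow> real) \<Rightarrow> ereal) \<Rightarrow> (nat \<Rightarrow> real) \<Rightarrow>
   nat \<Rightarrow> (nat \<Rightarrow> real) \<Rightarrow> (nat \<Rightarrow> real) \<Rightarrow> (nat \<Rightarrow> 'w \<Rightarrow> nat) \<Rightarrow>
   (nat \<Rightarrow> 'w \<Rightarrow> nat \<Rightarrow> real) \<Rightarrow> (nat \<Rightarrow> 'w \<Rightarrow> nat \<Rightarrow> real) \<Rightarrow> bool"
where
  "prox_gradient_run M d n f \<psi> G T \<eta> x1 idx g x \<longleftrightarrow>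
     prob_space M \<and> 1 \<le> T \<and> x1 \<in> eff_dom d \<psi> \<and>
     (\<forall>t\<in>{1..T}. 0 < \<eta> t) \<and>
     (\<forall>t\<in>{1..T}. idx t \<in> M \<rightarrow>\<^sub>M count_space {1..n}) \<and>
     (\<forall>t\<in>{1..T + 1}. x t \<in> borel_measurable M) \<and>
     (\<forall>\<omega>\<in>space M. x 1 \<omega> = x1) \<and>
     (\<forall>t\<in>{1..T}. \<forall>\<omega>\<in>space M.
        g t \<omega> \<in> subdifferential d (\<lambda>y. ereal (f (idx t \<omega>) y)) (x t \<omega>) \<and>
        vnorm d (g t \<omega>) \<le> G (idx t \<omega>) \<and>
        is_arg_min
          (\<lambda>y. \<psi> y + ereal (vinner d (g t \<omega>) y + (vnorm d (vdiff y (x t \<omega>)))\<^sup>2 / (2 * \<eta> t)))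
          (\<lambda>y. y \<in> Rd d) (x (t + 1) \<omega>))"

text \<open>
  Expectation of an extended-real random variable. In \<^typ>\<open>ereal\<close>, \<open>\<infinity> - \<infinity> = \<infinity>\<close>, so an upper
  bound below \<open>\<infinity>\<close> entails that the positive part has finite expectation.
\<close>

definition ereal_expectation :: "'w measure \<Rightarrow> ('w \<Rightarrow> ereal) \<Rightarrow> ereal" where
  "ereal_expectation M X =
     enn2ereal (\<integral>\<^sup>+\<omega>. e2ennreal (X \<omega>) \<partial>M) - enn2ereal (\<integral>\<^sup>+\<omega>. e2ennreal (- X \<omega>) \<partial>M)"

definition Gf2 :: "nat \<Rightarrow> (nat \<Rightarrow> real) \<Rightarrow> real" where
  "Gf2 n G = sqrt ((\<Sum>i=1..n. (G i)\<^sup>2) / real n)"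

definition gam :: "real \<Rightarrow> (nat \<Rightarrow> real) \<Rightarrow> nat \<Rightarrow> real" where
  "gam \<mu> \<eta> t = (\<Prod>s=1..<t. 1 + \<mu> * \<eta> s)"

end

theory Submission
  imports Defs
begin

text \<open>
  One proximal step satisfies, for every \<open>u\<close> in the domain of \<open>\<psi>\<close>, a descent inequality that
  bounds \<open>F\<close> at the new iterate by \<open>f\<^sub>i + \<psi>\<close> at \<open>u\<close>, up to a telescoping difference of squared
  distances to \<open>u\<close>, an error of order \<open>\<eta>\<^sub>t\<^sup>2\<close> and the sampling error \<open>\<Omega>\<^sub>t(x\<^sub>t)\<close>
  (\<open>step_inequality\<close>). With a fixed \<open>u = z\<close> this bounds an average of the values \<open>F(x\<^sub>t)\<close> only. A bound
  on the last value comes from a moving comparison point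
  \<open>z\<^sub>t = (w\<^sub>t\<^sub>-\<^sub>1 / w\<^sub>t) z\<^sub>t\<^sub>-\<^sub>1 + (1 - w\<^sub>t\<^sub>-\<^sub>1 / w\<^sub>t) x\<^sub>t\<close> with \<open>z\<^sub>0 = z\<close>, which
  drifts from \<open>z\<close> towards the iterates as the weights \<open>w\<^sub>t\<close> increase.

  Weigh the step inequality at \<open>u = z\<^sub>t\<close> by \<open>a\<^sub>t w\<^sub>t\<close>, where \<open>a\<^sub>t = \<gamma>\<^sub>t \<eta>\<^sub>t\<close>. The distances still
  telescope, because moving the comparison point towards \<open>x\<^sub>t\<close> shrinks its distance to \<open>x\<^sub>t\<close> by the
  factor \<open>w\<^sub>t\<^sub>-\<^sub>1 / w\<^sub>t\<close>. Convexity replaces \<open>f\<^sub>i + \<psi>\<close> at \<open>z\<^sub>t\<close> by a combination of its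
  values at \<open>z\<close> and at \<open>x\<^sub>1, ..., x\<^sub>t\<close>. The choice \<open>w\<^sub>t = 1 / (a\<^sub>t + ... + a\<^sub>T)\<close> is
  the one for which, after summation over \<open>t\<close>, every \<open>F(x\<^sub>s)\<close> with \<open>s \<le> T\<close> drops out and \<open>F(x\<^sub>T\<^sub>+\<^sub>1)\<close>
  keeps coefficient \<open>1\<close> (\<open>tail_weight_summation\<close>). All this happens for each outcome separately
  (\<open>pathwise_last_iterate_bound\<close>).

  Only then is the expectation taken. Because \<open>f\<^sub>i(z\<^sub>t)\<close> was expanded before averaging, the sampling
  errors occur at iterates \<open>x\<^sub>s\<close> with \<open>s \<le> t\<close>, where their mean is at most \<open>\<Phi> \<eta>\<^sub>s\<close>, and at the
  deterministic point \<open>z\<close>, where their mean vanishes. The weighted sum of the bounds \<open>\<Phi> \<eta>\<^sub>s\<close>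
  is evaluated by the same summation identity, now with \<open>\<eta>\<close> in place of \<open>F\<close>, and monotonicity of the
  stepsizes brings it to the form of the theorem. The constant obtained is \<open>2\<close>.
\<close>

section \<open>Vectors\<close>

lemma vnorm_sq: "(vnorm d x)\<^sup>2 = vinner d x x"
  by (simp add: vnorm_def vinner_def sum_nonneg)

lemma vnorm_nonneg: "0 \<le> vnorm d x"
  by (simp add: vnorm_def vinner_def sum_nonneg)

lemma vinner_le_vnorm: "\<bar>vinner d x y\<bar> \<le> vnorm d x * vnorm d y"
proof -
  have "\<bar>vinner d x y\<bar> \<le> (\<Sum>i<d. \<bar>x i\<bar> * \<bar>y i\<bar>)"
    unfolding vinner_def abs_mult[symmetric] by (rule sum_abs)
  also have "\<dots> \<le> L2_set x {..<d} * L2_set y {..<d}"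
    by (rule L2_set_mult_ineq)
  finally show ?thesis
    by (simp add: L2_set_def vnorm_def vinner_def power2_eq_square)
qed

lemma vinner_diff_left: "vinner d (vdiff x y) u = vinner d x u - vinner d y u"
  by (simp add: vinner_def vdiff_def algebra_simps sum_subtractf)

lemma vinner_diff_right: "vinner d u (vdiff x y) = vinner d u x - vinner d u y"
  by (simp add: vinner_def vdiff_def algebra_simps sum_subtractf)

lemma vinner_commute: "vinner d x y = vinner d y x"
  by (simp add: vinner_def mult.commute)

lemma vnorm_diff_commute: "vnorm d (vdiff x y) = vnorm d (vdiff y x)"
proof -
  have "vinner d (vdiff x y) (vdiff x y) = vinner d (vdiff y x) (vdiff y x)"
    by (simp add: vinner_diff_left vinner_diff_right)
  then show ?thesis by (simp add: vnorm_def)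
qed

lemma vinner_scaled_left: "vinner d (\<lambda>i. c * x i) y = c * vinner d x y"
  by (simp add: vinner_def sum_distrib_left mult.assoc)

lemma Rd_iff: "x \<in> Rd d \<longleftrightarrow> (\<forall>i\<ge>d. x i = 0)"
  by (simp add: Rd_def topspace_Euclidean_space)

lemma Rd_combination: "x \<in> Rd d \<Longrightarrow> y \<in> Rd d \<Longrightarrow> (\<lambda>i. a * x i + b * y i) \<in> Rd d"
  by (simp add: Rd_iff)

lemma three_point_identity:
  "2 * vinner d (vdiff x y) (vdiff u y)
     = (vnorm d (vdiff x y))\<^sup>2 + (vnorm d (vdiff u y))\<^sup>2 - (vnorm d (vdiff u x))\<^sup>2"
  by (simp add: vnorm_sq vinner_diff_left vinner_diff_right vinner_commute[of d x u]
      vinner_commute[of d y u] vinner_commute[of d y x] algebra_simps)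

lemma continuous_on_vnorm_diff: "continuous_on A (\<lambda>y. vnorm d (vdiff y x))"
proof -
  have "continuous_on A (\<lambda>y::nat \<Rightarrow> real. y i)" for i
    by (rule continuous_on_product_then_coordinatewise) (rule continuous_on_id)
  then show ?thesis
    unfolding vnorm_def vinner_def vdiff_def
    by (intro continuous_intros)
qed

section \<open>The effective domain\<close>

lemma eff_dom_in_Rd: "x \<in> eff_dom d \<psi> \<Longrightarrow> x \<in> Rd d"
  by (simp add: eff_dom_def)

lemma eff_dom_le_iff:
  assumes "proper_fun d \<psi>" "x \<in> eff_dom d \<psi>" "y \<in> eff_dom d \<psi>"
  shows "\<psi> x + ereal a \<le> \<psi> y + ereal b
           \<longleftrightarrow> real_of_ereal (\<psi> x) + a \<le> real_of_ereal (\<psi> y) + b"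
    and "\<psi> x + ereal a \<le> \<psi> y \<longleftrightarrow> real_of_ereal (\<psi> x) + a \<le> real_of_ereal (\<psi> y)"
  using assms unfolding proper_fun_def eff_dom_def by (cases "\<psi> x"; cases "\<psi> y"; auto)+

lemma convex_fun_real:
  assumes "proper_fun d \<psi>" "convex_fun d \<psi>" "x \<in> eff_dom d \<psi>" "y \<in> eff_dom d \<psi>"
    "0 \<le> u" "u \<le> 1"
  shows "(\<lambda>i. u * x i + (1 - u) * y i) \<in> eff_dom d \<psi>"
    and "real_of_ereal (\<psi> (\<lambda>i. u * x i + (1 - u) * y i))
           \<le> u * real_of_ereal (\<psi> x) + (1 - u) * real_of_ereal (\<psi> y)"
proof -
  let ?c = "\<lambda>i. u * x i + (1 - u) * y i"
  have xy: "x \<in> Rd d" "y \<in> Rd d" using assms(3,4) by (auto intro: eff_dom_in_Rd)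
  have le: "\<psi> ?c \<le> ereal u * \<psi> x + ereal (1 - u) * \<psi> y"
    using assms(2,5,6) xy unfolding convex_fun_def by auto
  have le': "\<psi> ?c \<le> ereal (u * real_of_ereal (\<psi> x) + (1 - u) * real_of_ereal (\<psi> y))"
    using assms(1,3,4) le unfolding proper_fun_def eff_dom_def by (cases "\<psi> x"; cases "\<psi> y") auto
  then show dom: "?c \<in> eff_dom d \<psi>"
    using Rd_combination[OF xy] by (auto simp: eff_dom_def)
  show "real_of_ereal (\<psi> ?c) \<le> u * real_of_ereal (\<psi> x) + (1 - u) * real_of_ereal (\<psi> y)"
    using le' assms(1) dom unfolding proper_fun_def eff_dom_def by (cases "\<psi> ?c") auto
qed

section \<open>The proximal step\<close>

abbreviation prox_step where
  "prox_step d \<psi> \<eta> g x y \<equiv>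
     is_arg_min (\<lambda>y. \<psi> y + ereal (vinner d g y + (vnorm d (vdiff y x))\<^sup>2 / (2 * \<eta>)))
       (\<lambda>y. y \<in> Rd d) y"

lemma prox_step_in_dom:
  assumes "proper_fun d \<psi>" "prox_step d \<psi> \<eta> g x y"
  shows "y \<in> eff_dom d \<psi>"
proof (rule ccontr)
  assume "y \<notin> eff_dom d \<psi>"
  then have inf: "\<psi> y = \<infinity>" using assms(2) by (auto simp: eff_dom_def is_arg_min_def)
  obtain u where u: "u \<in> eff_dom d \<psi>" using assms(1) by (auto simp: proper_fun_def)
  have "u \<in> Rd d" using u by (rule eff_dom_in_Rd)
  moreover have "\<psi> u + ereal (vinner d g u + (vnorm d (vdiff u x))\<^sup>2 / (2 * \<eta>)) < \<infinity>"
    using u by (auto simp: eff_dom_def)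
  ultimately show False using assms(2) inf by (auto simp: is_arg_min_def)
qed

text \<open>
  The first-order optimality condition: the minimality of \<open>y\<close> is tested at the points of the segment from \<open>y\<close> to \<open>u\<close>. Convexity of \<open>\<psi>\<close> makes the change
  of \<open>\<psi>\<close> at most linear in the position \<open>s\<close> on the segment, and the quadratic term contributes its
  derivative times \<open>s\<close> plus a term of order \<open>s\<^sup>2\<close>, which disappears after division by \<open>s\<close> in the
  limit \<open>s \<rightarrow> 0\<close>.
\<close>

lemma prox_step_subgradient:
  assumes pr: "proper_fun d \<psi>" and cv: "convex_fun d \<psi>" and \<eta>: "0 < \<eta>"
    and step: "prox_step d \<psi> \<eta> g x y" and x: "x \<in> Rd d" and g: "g \<in> Rd d"
  shows "(\<lambda>i. (x i - y i) / \<eta> - g i) \<in> subdifferential d \<psi> y"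
proof -
  let ?p = "\<lambda>x. real_of_ereal (\<psi> x)"
  let ?h = "\<lambda>i. (x i - y i) / \<eta> - g i"
  have y: "y \<in> eff_dom d \<psi>" by (rule prox_step_in_dom[OF pr step])
  have yR: "y \<in> Rd d" using y by (rule eff_dom_in_Rd)
  have hR: "?h \<in> Rd d" using x yR g by (simp add: Rd_iff)
  have "\<psi> y + ereal (vinner d ?h (vdiff u y)) \<le> \<psi> u" if uR: "u \<in> Rd d" for u
  proof (cases "u \<in> eff_dom d \<psi>")
    case False
    then show ?thesis using uR by (simp add: eff_dom_def)
  next
    case u: True
    let ?q = "\<lambda>y. vinner d g y + (vnorm d (vdiff y x))\<^sup>2 / (2 * \<eta>)"
    define B where "B = (vnorm d (vdiff u y))\<^sup>2 / (2 * \<eta>)"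
    have B: "0 \<le> B" using \<eta> by (simp add: B_def)
    have seg: "?p y + vinner d ?h (vdiff u y) \<le> ?p u + s * B" if s: "0 < s" "s \<le> 1" for s
    proof -
      let ?c = "\<lambda>i. s * u i + (1 - s) * y i"
      note c = convex_fun_real[OF pr cv u y, of s]
      have cd: "?c \<in> eff_dom d \<psi>" using c(1) s by simp
      have "\<psi> y + ereal (?q y) \<le> \<psi> ?c + ereal (?q ?c)"
        using step eff_dom_in_Rd[OF cd] by (auto simp: is_arg_min_linorder)
      then have "?p y + ?q y \<le> ?p ?c + ?q ?c"
        by (simp only: eff_dom_le_iff(1)[OF pr y cd])
      moreover have "?p ?c \<le> s * ?p u + (1 - s) * ?p y" using c(2) s by simp
      moreover have "?q ?c = ?q y - s * vinner d ?h (vdiff u y) + s * (s * B)"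
      proof -
        have *: "g i * (s * u i + (1 - s) * y i) + (s * u i + (1 - s) * y i - x i)\<^sup>2 / (2 * \<eta>)
            = g i * y i + (y i - x i)\<^sup>2 / (2 * \<eta>) - s * (((x i - y i) / \<eta> - g i) * (u i - y i))
              + s * (s * ((u i - y i)\<^sup>2 / (2 * \<eta>)))" for i
          using \<eta> by (simp add: field_simps power2_eq_square)
        have q: "?q w = (\<Sum>i<d. g i * w i + (w i - x i)\<^sup>2 / (2 * \<eta>))" for w
          unfolding vnorm_sq
          by (simp add: vinner_def vdiff_def sum.distrib power2_eq_square flip: sum_divide_distrib)
        have h: "vinner d ?h (vdiff u y) = (\<Sum>i<d. ((x i - y i) / \<eta> - g i) * (u i - y i))"
          by (simp only: vinner_def vdiff_def)
        have b: "B = (\<Sum>i<d. (u i - y i)\<^sup>2 / (2 * \<eta>))"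
          unfolding B_def vnorm_sq
          by (simp add: vinner_def vdiff_def power2_eq_square flip: sum_divide_distrib)
        show ?thesis
          unfolding q h b * by (simp only: sum.distrib sum_subtractf sum_distrib_left)
      qed
      ultimately have "s * (?p y + vinner d ?h (vdiff u y)) \<le> s * (?p u + s * B)"
        by (simp add: algebra_simps)
      then show ?thesis using s by simp
    qed
    have "?p y + vinner d ?h (vdiff u y) \<le> ?p u"
    proof (rule field_le_epsilon)
      fix e :: real assume e: "0 < e"
      \<comment> \<open>\<open>B + 1\<close> instead of \<open>B\<close>, since \<open>B = 0\<close> when \<open>u\<close> and \<open>y\<close> coincide\<close>
      have "min 1 (e / (B + 1)) * B \<le> e / (B + 1) * B"
        using B by (intro mult_right_mono) auto
      also have "\<dots> \<le> e" using B e by (simp add: field_simps)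
      finally show "?p y + vinner d ?h (vdiff u y) \<le> ?p u + e"
        using seg[of "min 1 (e / (B + 1))"] B e by fastforce
    qed
    then show ?thesis by (simp only: eff_dom_le_iff(2)[OF pr y u])
  qed
  then show ?thesis using hR by (simp add: subdifferential_def)
qed

text \<open>
  Monotonicity of the subdifferential of \<open>\<psi>\<close>, applied to the two subgradients given by the
  optimality conditions. It keeps the iterates of any two outcomes at bounded distance, so that the
  random variables below are bounded and may be integrated.
\<close>

lemma prox_step_nonexpansive:
  assumes pr: "proper_fun d \<psi>" and cv: "convex_fun d \<psi>" and \<eta>: "0 < \<eta>"
    and stepx: "prox_step d \<psi> \<eta> g x x'" and x: "x \<in> Rd d" and g: "g \<in> Rd d"
    and stepy: "prox_step d \<psi> \<eta> h y y'" and y: "y \<in> Rd d" and h: "h \<in> Rd d"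
  shows "vnorm d (vdiff x' y') \<le> vnorm d (vdiff x y) + \<eta> * (vnorm d g + vnorm d h)"
proof -
  let ?N = "vnorm d (vdiff x' y')"
  have x': "x' \<in> eff_dom d \<psi>" and y': "y' \<in> eff_dom d \<psi>"
    using prox_step_in_dom[OF pr] stepx stepy by blast+
  have R: "x' \<in> Rd d" "y' \<in> Rd d" using x' y' by (auto intro: eff_dom_in_Rd)
  let ?p = "\<lambda>i. (x i - x' i) / \<eta> - g i" and ?q = "\<lambda>i. (y i - y' i) / \<eta> - h i"
  have "\<psi> x' + ereal (vinner d ?p (vdiff y' x')) \<le> \<psi> y'"
    "\<psi> y' + ereal (vinner d ?q (vdiff x' y')) \<le> \<psi> x'"
    using prox_step_subgradient[OF pr cv \<eta> stepx x g] prox_step_subgradient[OF pr cv \<eta> stepy y h] R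
    by (auto simp: subdifferential_def)
  then have "vinner d ?p (vdiff y' x') + vinner d ?q (vdiff x' y') \<le> 0"
    unfolding eff_dom_le_iff(2)[OF pr x' y'] eff_dom_le_iff(2)[OF pr y' x'] by linarith
  moreover have "\<eta> * (vinner d ?p (vdiff y' x') + vinner d ?q (vdiff x' y'))
      = ?N\<^sup>2 - vinner d (vdiff x y) (vdiff x' y')
        + \<eta> * (vinner d g (vdiff x' y') - vinner d h (vdiff x' y'))"
  proof -
    have *: "\<eta> * (((x i - x' i) / \<eta> - g i) * (y' i - x' i) + ((y i - y' i) / \<eta> - h i) * (x' i - y' i))
        = (x' i - y' i) * (x' i - y' i) - (x i - y i) * (x' i - y' i)
          + \<eta> * (g i * (x' i - y' i) - h i * (x' i - y' i))" for i
      using \<eta> by (simp add: field_simps)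
    show ?thesis
      unfolding vnorm_sq vinner_def vdiff_def sum.distrib[symmetric] sum_subtractf[symmetric]
        sum_distrib_left *
      by simp
  qed
  ultimately have "?N\<^sup>2 \<le> vinner d (vdiff x y) (vdiff x' y')
        - \<eta> * (vinner d g (vdiff x' y') - vinner d h (vdiff x' y'))"
    using \<eta> mult_nonneg_nonpos[of \<eta>] by fastforce
  also have "\<dots> \<le> vnorm d (vdiff x y) * ?N + \<eta> * (vnorm d g * ?N + vnorm d h * ?N)"
  proof -
    have "- (vinner d g (vdiff x' y') - vinner d h (vdiff x' y')) \<le> vnorm d g * ?N + vnorm d h * ?N"
      using vinner_le_vnorm[of d g "vdiff x' y'"] vinner_le_vnorm[of d h "vdiff x' y'"] by linarith
    then have "\<eta> * - (vinner d g (vdiff x' y') - vinner d h (vdiff x' y'))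
        \<le> \<eta> * (vnorm d g * ?N + vnorm d h * ?N)"
      using \<eta> by (intro mult_left_mono) auto
    then show ?thesis using vinner_le_vnorm[of d "vdiff x y" "vdiff x' y'"] by linarith
  qed
  finally have "?N * ?N \<le> (vnorm d (vdiff x y) + \<eta> * (vnorm d g + vnorm d h)) * ?N"
    by (simp add: power2_eq_square algebra_simps)
  moreover have "0 \<le> vnorm d (vdiff x y) + \<eta> * (vnorm d g + vnorm d h)"
    using \<eta> by (simp add: vnorm_nonneg)
  ultimately show ?thesis
    using vnorm_nonneg[of d "vdiff x' y'"] by (cases "?N = 0") auto
qed

text \<open>
  The Lipschitz constant that comes out is the arithmetic mean of the \<open>G\<^sub>i\<close>; it is at most their
  quadratic mean.
\<close>

lemma favg_lipschitz:
  assumes "composite_problem d n f \<psi> \<mu> G" "x \<in> eff_dom d \<psi>" "y \<in> eff_dom d \<psi>"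
  shows "\<bar>favg n f x - favg n f y\<bar> \<le> Gf2 n G * vnorm d (vdiff x y)"
proof -
  have n: "1 \<le> n" using assms(1) by (simp add: composite_problem_def)
  have "\<bar>favg n f x - favg n f y\<bar> = \<bar>\<Sum>i=1..n. f i x - f i y\<bar> / n"
    by (simp add: favg_def sum_subtractf diff_divide_distrib[symmetric])
  also have "\<dots> \<le> (\<Sum>i=1..n. G i * vnorm d (vdiff x y)) / n"
    using assms unfolding composite_problem_def
    by (intro divide_right_mono order_trans[OF sum_abs] sum_mono) auto
  also have "\<dots> = (\<Sum>i=1..n. G i) / n * vnorm d (vdiff x y)"
    by (simp add: sum_distrib_right)
  also have "\<dots> \<le> Gf2 n G * vnorm d (vdiff x y)"
  proof (intro mult_right_mono vnorm_nonneg)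
    have "(\<Sum>i=1..n. G i)\<^sup>2 \<le> n * (\<Sum>i=1..n. (G i)\<^sup>2)"
      using Cauchy_Schwarz_ineq_sum[of "\<lambda>_. 1" G "{1..n}"] by simp
    then have "((\<Sum>i=1..n. G i) / n)\<^sup>2 \<le> (\<Sum>i=1..n. (G i)\<^sup>2) / n"
      using n by (simp add: power_divide power2_eq_square field_simps)
    then show "(\<Sum>i=1..n. G i) / n \<le> Gf2 n G"
      unfolding Gf2_def by (rule real_le_rsqrt)
  qed
  finally show ?thesis .
qed

text \<open>
  Strong convexity at the subgradient of \<open>\<psi>\<close> given by the optimality condition, rewritten by the
  three-point identity, gives the distances to \<open>u\<close> together with a gain \<open>\<parallel>y - x\<parallel>\<^sup>2\<close>. The gain pays for
  evaluating \<open>f\<close> at \<open>y\<close> rather than at \<open>x\<close> and for testing \<open>g\<close> against \<open>u - y\<close> rather than \<open>u - x\<close>.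
\<close>

lemma step_inequality:
  assumes cp: "composite_problem d n f \<psi> \<mu> G" and i: "i \<in> {1..n}" and \<eta>: "0 < \<eta>"
    and x: "x \<in> eff_dom d \<psi>" and g: "g \<in> subdifferential d (\<lambda>y. ereal (f i y)) x"
    and gG: "vnorm d g \<le> G i" and step: "prox_step d \<psi> \<eta> g x y" and u: "u \<in> eff_dom d \<psi>"
  shows "2 * \<eta> * (favg n f y + real_of_ereal (\<psi> y) + (f i x - favg n f x))
           + (1 + \<mu> * \<eta>) * (vnorm d (vdiff u y))\<^sup>2
         \<le> 2 * \<eta> * (f i u + real_of_ereal (\<psi> u)) + (vnorm d (vdiff u x))\<^sup>2
           + 2 * \<eta> * (\<eta> * ((Gf2 n G)\<^sup>2 + (G i)\<^sup>2))"
proof -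
  let ?p = "\<lambda>x. real_of_ereal (\<psi> x)"
  let ?h = "\<lambda>i. (x i - y i) / \<eta> - g i"
  have pr: "proper_fun d \<psi>" and cv: "convex_fun d \<psi>" using cp by (auto simp: composite_problem_def)
  have y: "y \<in> eff_dom d \<psi>" by (rule prox_step_in_dom[OF pr step])
  have R: "x \<in> Rd d" "y \<in> Rd d" "u \<in> Rd d" "g \<in> Rd d"
    using x y u g by (auto intro: eff_dom_in_Rd simp: subdifferential_def)
  define \<delta> where "\<delta> = vnorm d (vdiff y x)"
  have "?h \<in> subdifferential d \<psi> y" using prox_step_subgradient[OF pr cv \<eta> step] R by blast
  then have "ereal (\<mu> / 2 * (vnorm d (vdiff u y))\<^sup>2) \<le> \<psi> u - \<psi> y - ereal (vinner d ?h (vdiff u y))"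
    using cp R y by (auto simp: composite_problem_def)
  then have sc: "\<mu> / 2 * (vnorm d (vdiff u y))\<^sup>2 \<le> ?p u - ?p y - vinner d ?h (vdiff u y)"
    using pr u y unfolding proper_fun_def eff_dom_def by (cases "\<psi> u"; cases "\<psi> y") auto
  have "vinner d ?h (vdiff u y) = vinner d (vdiff x y) (vdiff u y) / \<eta> - vinner d g (vdiff u y)"
    by (simp add: vinner_def vdiff_def sum_divide_distrib sum_subtractf[symmetric] algebra_simps)
  then have "2 * \<eta> * vinner d ?h (vdiff u y)
      = 2 * vinner d (vdiff x y) (vdiff u y) - 2 * \<eta> * vinner d g (vdiff u y)"
    using \<eta> by (simp only:) (simp add: algebra_simps)
  then have h: "2 * \<eta> * vinner d ?h (vdiff u y)
      = \<delta>\<^sup>2 + (vnorm d (vdiff u y))\<^sup>2 - (vnorm d (vdiff u x))\<^sup>2 - 2 * \<eta> * vinner d g (vdiff u y)"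
    unfolding \<delta>_def three_point_identity vnorm_diff_commute[of d y x] .
  have "2 * \<eta> * (\<mu> / 2 * (vnorm d (vdiff u y))\<^sup>2)
      \<le> 2 * \<eta> * (?p u - ?p y - vinner d ?h (vdiff u y))"
    using sc \<eta> by (intro mult_left_mono) auto
  then have A: "2 * \<eta> * ?p y + (1 + \<mu> * \<eta>) * (vnorm d (vdiff u y))\<^sup>2 + \<delta>\<^sup>2
      \<le> 2 * \<eta> * ?p u + (vnorm d (vdiff u x))\<^sup>2 + 2 * \<eta> * vinner d g (vdiff u y)"
    using h by (simp add: algebra_simps)
  have "f i x + vinner d g (vdiff u x) \<le> f i u"
    using g R by (auto simp: subdifferential_def)
  moreover have "vinner d g (vdiff u y) = vinner d g (vdiff u x) - vinner d g (vdiff y x)"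
    by (simp add: vinner_diff_right)
  moreover have "- vinner d g (vdiff y x) \<le> G i * \<delta>"
    using vinner_le_vnorm[of d g "vdiff y x"] mult_right_mono[OF gG vnorm_nonneg[of d "vdiff y x"]]
    by (simp add: \<delta>_def)
  moreover have "favg n f y - favg n f x \<le> Gf2 n G * \<delta>"
    using favg_lipschitz[OF cp y x] by (simp add: \<delta>_def)
  ultimately have "vinner d g (vdiff u y) + favg n f y + (f i x - favg n f x)
      \<le> f i u + (Gf2 n G * \<delta> + G i * \<delta>)"
    by linarith
  then have B: "2 * \<eta> * (vinner d g (vdiff u y) + favg n f y + (f i x - favg n f x))
      \<le> 2 * \<eta> * (f i u + (Gf2 n G * \<delta> + G i * \<delta>))"
    using \<eta> by (intro mult_left_mono) auto
  \<comment> \<open>Young's inequality absorbs both costs, which are linear in \<open>\<delta>\<close>, into the gain\<close>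
  have C: "2 * \<eta> * (Gf2 n G * \<delta> + G i * \<delta>) \<le> \<delta>\<^sup>2 + 2 * \<eta> * (\<eta> * ((Gf2 n G)\<^sup>2 + (G i)\<^sup>2))"
  proof -
    have "0 \<le> (\<delta> - \<eta> * (Gf2 n G + G i))\<^sup>2 + \<eta>\<^sup>2 * (Gf2 n G - G i)\<^sup>2" by simp
    also have "\<dots> = \<delta>\<^sup>2 + 2 * \<eta> * (\<eta> * ((Gf2 n G)\<^sup>2 + (G i)\<^sup>2)) - 2 * \<eta> * (Gf2 n G * \<delta> + G i * \<delta>)"
      by (simp add: power2_eq_square algebra_simps)
    finally show ?thesis by simp
  qed
  from A B C show ?thesis by (simp add: algebra_simps)
qed


section \<open>Weights and comparison points\<close>

text \<open>
  The maximum gives time \<open>0\<close> the weight of time \<open>1\<close>, so that the first update of the comparison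
  point is trivial: it is still \<open>z\<close> at time \<open>1\<close>.
\<close>

definition tail_weight :: "(nat \<Rightarrow> real) \<Rightarrow> nat \<Rightarrow> nat \<Rightarrow> real" where
  "tail_weight a T t = 1 / (\<Sum>s=max 1 t..T. a s)"

lemma tail_sum_pos:
  fixes a :: "nat \<Rightarrow> real"
  assumes "\<And>t. t \<in> {1..T} \<Longrightarrow> 0 < a t" "1 \<le> T" "t \<le> T"
  shows "0 < (\<Sum>s=max 1 t..T. a s)"
  using assms by (intro sum_pos) auto

lemma tail_weight_pos:
  assumes "\<And>t. t \<in> {1..T} \<Longrightarrow> 0 < a t" "1 \<le> T" "t \<le> T"
  shows "0 < tail_weight a T t"
  using tail_sum_pos[of T a t] assms by (simp add: tail_weight_def)

lemma tail_weight_mono: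
  assumes "\<And>t. t \<in> {1..T} \<Longrightarrow> 0 < a t" "1 \<le> T" "Suc t \<le> T"
  shows "tail_weight a T t \<le> tail_weight a T (Suc t)"
proof -
  have "(\<Sum>s=max 1 (Suc t)..T. a s) \<le> (\<Sum>s=max 1 t..T. a s)"
    using assms(1) by (intro sum_mono2) (auto intro: less_imp_le)
  then show ?thesis
    unfolding tail_weight_def using tail_sum_pos[of T a "Suc t"] assms by (intro divide_left_mono) auto
qed

text \<open>
  The recursion that determines the weights: the value at \<open>x\<^sub>t\<^sub>+\<^sub>1\<close> enters positively through step
  \<open>t\<close> (right-hand side) and negatively through the comparison points of all later steps
  (left-hand side), and the two have to balance.
\<close>

lemma tail_weight_diff:
  assumes "\<And>t. t \<in> {1..T} \<Longrightarrow> 0 < a t" "1 \<le> t" "Suc t \<le> T"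
  shows "(\<Sum>s=Suc t..T. a s) * (tail_weight a T (Suc t) - tail_weight a T t) = a t * tail_weight a T t"
proof -
  have "0 < (\<Sum>s=Suc t..T. a s)" "0 < (\<Sum>s=t..T. a s)"
    using tail_sum_pos[of T a "Suc t"] tail_sum_pos[of T a t] assms by auto
  moreover have "(\<Sum>s=t..T. a s) = a t + (\<Sum>s=Suc t..T. a s)"
    using assms by (intro sum.atLeast_Suc_atMost) simp
  moreover have "B * (1 / B - 1 / A) = b * (1 / A)" if "0 < B" "0 < A" "A = b + B" for A B b :: real
    using that(1,2) by (simp add: that(3) right_diff_distrib) (simp add: divide_simps)
  ultimately show ?thesis
    using assms by (simp add: tail_weight_def max_absorb2)
qed

text \<open>
  After exchanging the sums, the coefficient of \<open>D s\<close> is the left-hand side of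
  \<open>tail_weight_diff\<close>; the term \<open>s = 1\<close> drops out because \<open>w 0 = w 1\<close>. It is used twice: with the
  values of \<open>F\<close> at the iterates, and with the bounds on the sampling errors.
\<close>

lemma tail_weight_summation:
  assumes "\<And>t. t \<in> {1..T} \<Longrightarrow> 0 < a t" "1 \<le> T"
  defines "w \<equiv> tail_weight a T"
  shows "(\<Sum>t=1..T. a t * (\<Sum>s=1..t. (w s - w (s - 1)) * D s)) = (\<Sum>t=1..<T. a t * w t * D (Suc t))"
proof -
  have "(\<Sum>t=1..T. a t * (\<Sum>s=1..t. (w s - w (s - 1)) * D s))
      = (\<Sum>t\<in>{1..T}. \<Sum>s | s \<in> {1..T} \<and> s \<le> t. a t * ((w s - w (s - 1)) * D s))"
    unfolding sum_distrib_left by (intro sum.cong) auto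
  also have "\<dots> = (\<Sum>s\<in>{1..T}. \<Sum>t | t \<in> {1..T} \<and> s \<le> t. a t * ((w s - w (s - 1)) * D s))"
    by (rule sum.swap_restrict) auto
  also have "\<dots> = (\<Sum>s\<in>{1..T}. (\<Sum>t=s..T. a t) * (w s - w (s - 1)) * D s)"
    by (intro sum.cong refl) (auto simp: sum_distrib_right mult.assoc intro!: sum.cong)
  also have "\<dots> = (\<Sum>s\<in>{Suc 1..T}. (\<Sum>t=s..T. a t) * (w s - w (s - 1)) * D s)"
    using assms(2) by (subst sum.atLeast_Suc_atMost) (auto simp: w_def tail_weight_def)
  also have "\<dots> = (\<Sum>t\<in>{1..<T}. (\<Sum>t=Suc t..T. a t) * (w (Suc t) - w t) * D (Suc t))"
    by (rule sum.reindex_bij_witness[of _ Suc "\<lambda>s. s - 1"]) auto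
  also have "\<dots> = (\<Sum>t=1..<T. a t * w t * D (Suc t))"
    unfolding w_def using tail_weight_diff[of T a] assms(1) by (intro sum.cong) auto
  finally show ?thesis .
qed

primrec comparison_point ::
  "(nat \<Rightarrow> real) \<Rightarrow> (nat \<Rightarrow> nat \<Rightarrow> real) \<Rightarrow> (nat \<Rightarrow> real) \<Rightarrow> nat \<Rightarrow> nat \<Rightarrow> real" where
  "comparison_point w x z 0 = z"
| "comparison_point w x z (Suc t) =
     (\<lambda>i. w t / w (Suc t) * comparison_point w x z t i + (1 - w t / w (Suc t)) * x (Suc t) i)"

text \<open>
  Jensen's inequality unrolled along the recursion. Multiplication by \<open>w t\<close> turns the convex
  coefficients into the increments of \<open>w\<close>.
\<close>

lemma comparison_point_convex:
  fixes h :: "(nat \<Rightarrow> real) \<Rightarrow> real"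
  assumes S: "\<And>x y u. x \<in> S \<Longrightarrow> y \<in> S \<Longrightarrow> 0 \<le> u \<Longrightarrow> u \<le> 1 \<Longrightarrow> (\<lambda>i. u * x i + (1 - u) * y i) \<in> S"
    and h: "\<And>x y u. x \<in> S \<Longrightarrow> y \<in> S \<Longrightarrow> 0 \<le> u \<Longrightarrow> u \<le> 1 \<Longrightarrow>
              h (\<lambda>i. u * x i + (1 - u) * y i) \<le> u * h x + (1 - u) * h y"
    and w: "\<And>t. t \<le> T \<Longrightarrow> 0 < w t" "\<And>t. Suc t \<le> T \<Longrightarrow> w t \<le> w (Suc t)"
    and x: "\<And>t. t \<in> {1..T} \<Longrightarrow> x t \<in> S" and z: "z \<in> S" and t: "t \<le> T"
  shows "comparison_point w x z t \<in> S"
    and "w t * h (comparison_point w x z t) \<le> w 0 * h z + (\<Sum>s=1..t. (w s - w (s - 1)) * h (x s))"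
proof -
  let ?z = "comparison_point w x z"
  have "?z t \<in> S \<and> w t * h (?z t) \<le> w 0 * h z + (\<Sum>s=1..t. (w s - w (s - 1)) * h (x s))"
    using t
  proof (induction t)
    case 0
    then show ?case using z by simp
  next
    case (Suc t)
    define u where "u = w t / w (Suc t)"
    have pos: "0 < w (Suc t)" "0 < w t" "w t \<le> w (Suc t)" using w Suc.prems by auto
    have u: "0 \<le> u" "u \<le> 1" "w (Suc t) * u = w t" using pos by (auto simp: u_def)
    have IH: "?z t \<in> S" "w t * h (?z t) \<le> w 0 * h z + (\<Sum>s=1..t. (w s - w (s - 1)) * h (x s))"
      using Suc by auto
    have xS: "x (Suc t) \<in> S" using x Suc.prems by auto
    have zS: "?z (Suc t) = (\<lambda>i. u * ?z t i + (1 - u) * x (Suc t) i)" by (simp add: u_def)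
    have "w (Suc t) * h (?z (Suc t)) \<le> w (Suc t) * (u * h (?z t) + (1 - u) * h (x (Suc t)))"
      unfolding zS using h[OF IH(1) xS u(1,2)] pos by (intro mult_left_mono) auto
    also have "\<dots> = (w (Suc t) * u) * h (?z t) + (w (Suc t) - w (Suc t) * u) * h (x (Suc t))"
      by (simp add: algebra_simps)
    also have "\<dots> \<le> w 0 * h z + (\<Sum>s=1..Suc t. (w s - w (s - 1)) * h (x s))"
      using IH(2) unfolding u(3) by simp
    finally show ?case using S[OF IH(1) xS u(1,2)] zS by simp
  qed
  then show "?z t \<in> S"
    and "w t * h (?z t) \<le> w 0 * h z + (\<Sum>s=1..t. (w s - w (s - 1)) * h (x s))" by auto
qed

text \<open>
  The squared distance shrinks by the factor \<open>(w t / w (Suc t))\<^sup>2\<close>. One of the two factors pays for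
  the growth of the weight, the other is bounded by \<open>1\<close>.
\<close>

lemma comparison_point_contracts:
  assumes "0 < w t" "w t \<le> w (Suc t)"
  shows "w (Suc t) * (vnorm d (vdiff (comparison_point w x z (Suc t)) (x (Suc t))))\<^sup>2
           \<le> w t * (vnorm d (vdiff (comparison_point w x z t) (x (Suc t))))\<^sup>2"
proof -
  define u where "u = w t / w (Suc t)"
  have u: "0 \<le> u" "u \<le> 1" "w (Suc t) * u = w t" using assms by (auto simp: u_def)
  let ?e = "vdiff (comparison_point w x z t) (x (Suc t))"
  have "vdiff (comparison_point w x z (Suc t)) (x (Suc t)) = (\<lambda>i. u * ?e i)"
    by (simp add: vdiff_def u_def algebra_simps)
  then have "(vnorm d (vdiff (comparison_point w x z (Suc t)) (x (Suc t))))\<^sup>2 = u * (u * (vnorm d ?e)\<^sup>2)"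
    by (simp only: vnorm_sq vinner_scaled_left vinner_commute[of d ?e "\<lambda>i. u * ?e i"])
  then have "w (Suc t) * (vnorm d (vdiff (comparison_point w x z (Suc t)) (x (Suc t))))\<^sup>2
      = u * (w t * (vnorm d ?e)\<^sup>2)"
    using u(3) by (metis mult.assoc mult.commute)
  also have "\<dots> \<le> 1 * (w t * (vnorm d ?e)\<^sup>2)"
    using u assms by (intro mult_right_mono) auto
  finally show ?thesis by simp
qed

lemma gam_pos:
  assumes "0 \<le> \<mu>" "\<And>t. t \<in> {1..T} \<Longrightarrow> 0 < \<eta> t" "t \<le> T + 1"
  shows "0 < gam \<mu> \<eta> t"
  unfolding gam_def
proof (rule prod_pos)
  fix s assume "s \<in> {1..<t}"
  then have "0 \<le> \<mu> * \<eta> s" using assms(1,3) assms(2)[of s] by (intro mult_nonneg_nonneg) auto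
  then show "0 < 1 + \<mu> * \<eta> s" by simp
qed

lemma gam_Suc: "1 \<le> t \<Longrightarrow> gam \<mu> \<eta> (Suc t) = gam \<mu> \<eta> t * (1 + \<mu> * \<eta> t)"
  by (simp add: gam_def)

text \<open>
  The weighted step inequalities at the comparison points, summed over one run. The sampling errors
  \<open>\<Omega>\<close> are left untouched, since they are controlled only on average.
\<close>

lemma pathwise_last_iterate_bound:
  fixes x :: "nat \<Rightarrow> nat \<Rightarrow> real"
  assumes cp: "composite_problem d n f \<psi> \<mu> G" and T: "1 \<le> T"
    and \<eta>: "\<And>t. t \<in> {1..T} \<Longrightarrow> 0 < \<eta> t" and j: "\<And>t. t \<in> {1..T} \<Longrightarrow> j t \<in> {1..n}"
    and x1: "x 1 \<in> eff_dom d \<psi>"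
    and g: "\<And>t. t \<in> {1..T} \<Longrightarrow> g t \<in> subdifferential d (\<lambda>y. ereal (f (j t) y)) (x t)"
    and gG: "\<And>t. t \<in> {1..T} \<Longrightarrow> vnorm d (g t) \<le> G (j t)"
    and step: "\<And>t. t \<in> {1..T} \<Longrightarrow> prox_step d \<psi> (\<eta> t) (g t) (x t) (x (t + 1))"
    and z: "z \<in> eff_dom d \<psi>"
  defines "a \<equiv> (\<lambda>t. gam \<mu> \<eta> t * \<eta> t)"
  defines "w \<equiv> tail_weight a T"
  defines "\<Omega> \<equiv> (\<lambda>t y. f (j t) y - favg n f y)"
  shows "(favg n f (x (T + 1)) + real_of_ereal (\<psi> (x (T + 1)))) - (favg n f z + real_of_ereal (\<psi> z))
    \<le> w 0 / 2 * (vnorm d (vdiff z (x 1)))\<^sup>2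
      + (\<Sum>t=1..T. a t * (w t * \<eta> t * ((Gf2 n G)\<^sup>2 + (G (j t))\<^sup>2)))
      + (\<Sum>t=1..T. a t * (w 0 * \<Omega> t z + (\<Sum>s=1..t. (w s - w (s - 1)) * \<Omega> t (x s)) - w t * \<Omega> t (x t)))"
proof -
  let ?p = "\<lambda>y. real_of_ereal (\<psi> y)"
  let ?F = "\<lambda>y. favg n f y + ?p y"
  let ?E = "\<lambda>t. w t * \<eta> t * ((Gf2 n G)\<^sup>2 + (G (j t))\<^sup>2)"
  have pr: "proper_fun d \<psi>" and cv: "convex_fun d \<psi>" and \<mu>: "0 \<le> \<mu>"
    and fcv: "\<And>i. i \<in> {1..n} \<Longrightarrow> convex_fun d (\<lambda>x. ereal (f i x))"
    using cp by (auto simp: composite_problem_def)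
  have xd: "x t \<in> eff_dom d \<psi>" if "t \<in> {1..T + 1}" for t
  proof (cases "t = 1")
    case False
    then have "t - 1 \<in> {1..T}" "t - 1 + 1 = t" using that by auto
    then show ?thesis using prox_step_in_dom[OF pr step[of "t - 1"]] by simp
  qed (use x1 in simp)
  have a: "0 < a t" if "t \<in> {1..T}" for t
    unfolding a_def using that \<eta> gam_pos[of \<mu> T \<eta> t] \<mu> by simp
  have w: "0 < w t" if "t \<le> T" for t
    unfolding w_def using tail_weight_pos[of T a t] a T that by simp
  have wm: "w t \<le> w (Suc t)" if "Suc t \<le> T" for t
    unfolding w_def using tail_weight_mono[of T a t] a T that by simp
  define y where "y = comparison_point w x z"
  have convex: "y t \<in> eff_dom d \<psi>"
    "w t * (f (j t) (y t) + ?p (y t))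
       \<le> w 0 * (f (j t) z + ?p z) + (\<Sum>s=1..t. (w s - w (s - 1)) * (f (j t) (x s) + ?p (x s)))"
    if t: "t \<in> {1..T}" for t
  proof -
    have S: "(\<lambda>i. u * b i + (1 - u) * c i) \<in> eff_dom d \<psi>"
      if "b \<in> eff_dom d \<psi>" "c \<in> eff_dom d \<psi>" "0 \<le> u" "u \<le> 1" for b c u
      by (rule convex_fun_real(1)[OF pr cv that])
    have h: "f (j t) (\<lambda>i. u * b i + (1 - u) * c i) + ?p (\<lambda>i. u * b i + (1 - u) * c i)
        \<le> u * (f (j t) b + ?p b) + (1 - u) * (f (j t) c + ?p c)"
      if "b \<in> eff_dom d \<psi>" "c \<in> eff_dom d \<psi>" "0 \<le> u" "u \<le> 1" for b c u
    proof -
      have "f (j t) (\<lambda>i. u * b i + (1 - u) * c i) \<le> u * f (j t) b + (1 - u) * f (j t) c"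
        using fcv[OF j[OF t]] eff_dom_in_Rd[OF that(1)] eff_dom_in_Rd[OF that(2)] that(3,4)
        by (simp add: convex_fun_def)
      then show ?thesis using convex_fun_real(2)[OF pr cv that] by (simp add: algebra_simps)
    qed
    have xdT: "x s \<in> eff_dom d \<psi>" if "s \<in> {1..T}" for s using xd[of s] that by simp
    have tT: "t \<le> T" using t by simp
    note c = comparison_point_convex[where h = "\<lambda>y. f (j t) y + ?p y" and S = "eff_dom d \<psi>"
          and T = T and w = w and x = x and z = z and t = t, OF S h w wm xdT z tT]
    show "y t \<in> eff_dom d \<psi>" unfolding y_def by (rule c(1))
    show "w t * (f (j t) (y t) + ?p (y t))
       \<le> w 0 * (f (j t) z + ?p z) + (\<Sum>s=1..t. (w s - w (s - 1)) * (f (j t) (x s) + ?p (x s)))"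
      unfolding y_def by (rule c(2))
  qed
  \<comment> \<open>The telescoping potential; the factor \<open>1 + \<mu> \<eta>\<^sub>t\<close> gained from strong convexity is what makes
    \<open>\<gamma>\<^sub>t\<close> advance to \<open>\<gamma>\<^sub>t\<^sub>+\<^sub>1\<close>.\<close>
  define P where "P = (\<lambda>t. gam \<mu> \<eta> (Suc t) * w t / 2 * (vnorm d (vdiff (y t) (x (Suc t))))\<^sup>2)"
  have one: "a t * w t * ?F (x (Suc t)) + P t - P (t - 1)
      \<le> a t * (w 0 * ?F z) + a t * (\<Sum>s=1..t. (w s - w (s - 1)) * ?F (x s)) + a t * ?E t
        + a t * (w 0 * \<Omega> t z + (\<Sum>s=1..t. (w s - w (s - 1)) * \<Omega> t (x s)) - w t * \<Omega> t (x t))"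
    if t: "t \<in> {1..T}" for t
  proof -
    have \<gamma>: "0 < gam \<mu> \<eta> t" using gam_pos[of \<mu> T \<eta> t] \<mu> \<eta> t by simp
    define c where "c = gam \<mu> \<eta> t * w t / 2"
    have c: "0 \<le> c" using \<gamma> w t by (simp add: c_def less_imp_le)
    have c2: "c * (2 * \<eta> t * r) = a t * w t * r" for r by (simp add: c_def a_def)
    have "c * (2 * \<eta> t * (?F (x (Suc t)) + \<Omega> t (x t)) + (1 + \<mu> * \<eta> t) * (vnorm d (vdiff (y t) (x (Suc t))))\<^sup>2)
      \<le> c * (2 * \<eta> t * (f (j t) (y t) + ?p (y t)) + (vnorm d (vdiff (y t) (x t)))\<^sup>2
          + 2 * \<eta> t * (\<eta> t * ((Gf2 n G)\<^sup>2 + (G (j t))\<^sup>2)))"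
      using step_inequality[OF cp j[OF t] \<eta>[OF t] _ g[OF t] gG[OF t] step[OF t] convex(1)[OF t]] xd t c
      unfolding \<Omega>_def by (intro mult_left_mono) auto
    moreover have "c * ((1 + \<mu> * \<eta> t) * (vnorm d (vdiff (y t) (x (Suc t))))\<^sup>2) = P t"
      using t by (simp add: P_def c_def gam_Suc)
    moreover have "c * (vnorm d (vdiff (y t) (x t)))\<^sup>2 \<le> P (t - 1)"
    proof -
      obtain t' where t': "t = Suc t'" using t by (cases t) auto
      have "w t * (vnorm d (vdiff (y t) (x t)))\<^sup>2 \<le> w t' * (vnorm d (vdiff (y t') (x t)))\<^sup>2"
        unfolding t' y_def using w[of t'] wm[of t'] t t' by (intro comparison_point_contracts) auto
      then have "gam \<mu> \<eta> t / 2 * (w t * (vnorm d (vdiff (y t) (x t)))\<^sup>2)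
          \<le> gam \<mu> \<eta> t / 2 * (w t' * (vnorm d (vdiff (y t') (x t)))\<^sup>2)"
        using \<gamma> by (intro mult_left_mono) auto
      then show ?thesis by (simp add: P_def c_def t' algebra_simps)
    qed
    ultimately have 1: "a t * w t * (?F (x (Suc t)) + \<Omega> t (x t)) + P t - P (t - 1)
        \<le> a t * w t * (f (j t) (y t) + ?p (y t)) + a t * ?E t"
      unfolding distrib_left[of c] c2 by (simp add: mult.assoc)
    \<comment> \<open>expand the component \<open>f (j t)\<close>, which is convex, and split off \<open>\<Omega> t\<close>, which is not, only afterwards\<close>
    have "a t * (w t * (f (j t) (y t) + ?p (y t)))
        \<le> a t * (w 0 * (f (j t) z + ?p z) + (\<Sum>s=1..t. (w s - w (s - 1)) * (f (j t) (x s) + ?p (x s))))"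
      using convex(2)[OF t] a[OF t] by (intro mult_left_mono) auto
    also have "(\<Sum>s=1..t. (w s - w (s - 1)) * (f (j t) (x s) + ?p (x s)))
        = (\<Sum>s=1..t. (w s - w (s - 1)) * ?F (x s)) + (\<Sum>s=1..t. (w s - w (s - 1)) * \<Omega> t (x s))"
      unfolding sum.distrib[symmetric] by (intro sum.cong) (auto simp: \<Omega>_def algebra_simps)
    also have "f (j t) z + ?p z = ?F z + \<Omega> t z" by (simp add: \<Omega>_def)
    finally show ?thesis using 1 by (simp add: algebra_simps)
  qed
  have tel: "(\<Sum>t=1..T. P t - P (t - 1)) = P T - P 0"
    using sum_telescope''[of 0 T P] by simp
  have "0 \<le> P T"
    using gam_pos[of \<mu> T \<eta> "Suc T"] \<mu> \<eta> w[of T] by (simp add: P_def)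
  moreover have "P 0 = w 0 / 2 * (vnorm d (vdiff z (x 1)))\<^sup>2" by (simp add: P_def gam_def y_def)
  moreover have "(\<Sum>t=1..T. a t * (w 0 * ?F z)) = ?F z"
  proof -
    have "(\<Sum>t=1..T. a t) * w 0 = 1"
      using tail_sum_pos[of T a 0] a T by (simp add: w_def tail_weight_def)
    then show ?thesis by (simp only: sum_distrib_right[symmetric] mult.assoc[symmetric]) simp
  qed
  moreover have "(\<Sum>t=1..T. a t * w t * ?F (x (Suc t)))
      = (\<Sum>t=1..<T. a t * w t * ?F (x (Suc t))) + ?F (x (T + 1))"
  proof -
    have "{1..T} = insert T {1..<T}" using T by auto
    moreover have "a T * w T = 1" using a[of T] T by (simp add: w_def tail_weight_def)
    ultimately show ?thesis by (simp add: add.commute)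
  qed
  moreover have "(\<Sum>t=1..T. a t * (\<Sum>s=1..t. (w s - w (s - 1)) * ?F (x s)))
      = (\<Sum>t=1..<T. a t * w t * ?F (x (Suc t)))"
    unfolding w_def using tail_weight_summation[of T a "\<lambda>s. ?F (x s)"] a T by simp
  moreover have "(\<Sum>t=1..T. a t * w t * ?F (x (Suc t)) + (P t - P (t - 1)))
      \<le> (\<Sum>t=1..T. a t * (w 0 * ?F z) + a t * (\<Sum>s=1..t. (w s - w (s - 1)) * ?F (x s)) + a t * ?E t
        + a t * (w 0 * \<Omega> t z + (\<Sum>s=1..t. (w s - w (s - 1)) * \<Omega> t (x s)) - w t * \<Omega> t (x t)))"
    using one by (intro sum_mono) (auto simp: add_diff_eq)
  ultimately show ?thesis
    unfolding sum.distrib[of _ _ "{1..T}"] tel by linarith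
qed

section \<open>Expectations\<close>

lemma run_step:
  assumes run: "prox_gradient_run M d n f \<psi> G T \<eta> x1 idx g x" and "\<omega> \<in> space M" "t \<in> {1..T}"
  shows "idx t \<omega> \<in> {1..n}"
    and "g t \<omega> \<in> subdifferential d (\<lambda>y. ereal (f (idx t \<omega>) y)) (x t \<omega>)"
    and "vnorm d (g t \<omega>) \<le> G (idx t \<omega>)"
    and "prox_step d \<psi> (\<eta> t) (g t \<omega>) (x t \<omega>) (x (t + 1) \<omega>)"
proof -
  have "idx t \<in> M \<rightarrow>\<^sub>M count_space {1..n}"
    using run assms(3) unfolding prox_gradient_run_def by blast
  from measurable_space[OF this assms(2)] show "idx t \<omega> \<in> {1..n}" by simp
qed (use assms in \<open>unfold prox_gradient_run_def, blast+\<close>)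

lemma run_basic:
  assumes "prox_gradient_run M d n f \<psi> G T \<eta> x1 idx g x"
  shows "prob_space M" and "1 \<le> T" and "x1 \<in> eff_dom d \<psi>"
    and "t \<in> {1..T} \<Longrightarrow> 0 < \<eta> t"
    and "t \<in> {1..T} \<Longrightarrow> idx t \<in> M \<rightarrow>\<^sub>M count_space {1..n}"
    and "t \<in> {1..T + 1} \<Longrightarrow> x t \<in> borel_measurable M"
    and "\<omega> \<in> space M \<Longrightarrow> x 1 \<omega> = x1"
  using assms unfolding prox_gradient_run_def by blast+

lemma run_in_dom:
  assumes "composite_problem d n f \<psi> \<mu> G" "prox_gradient_run M d n f \<psi> G T \<eta> x1 idx g x"
    "\<omega> \<in> space M" "t \<in> {1..T + 1}"
  shows "x t \<omega> \<in> eff_dom d \<psi>"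
proof (cases "t = 1")
  case True
  then show ?thesis using run_basic(3)[OF assms(2)] run_basic(7)[OF assms(2,3)] by simp
next
  case False
  then have "t - 1 \<in> {1..T}" "t - 1 + 1 = t" using assms(4) by auto
  then have "prox_step d \<psi> (\<eta> (t - 1)) (g (t - 1) \<omega>) (x (t - 1) \<omega>) (x t \<omega>)"
    using run_step(4)[OF assms(2,3), of "t - 1"] by (simp only:)
  then show ?thesis using assms(1) by (intro prox_step_in_dom) (auto simp: composite_problem_def)
qed

text \<open>
  Two runs start at the same point, and each step increases the distance between them by at most a
  constant.
\<close>

lemma run_diameter:
  assumes cp: "composite_problem d n f \<psi> \<mu> G" and run: "prox_gradient_run M d n f \<psi> G T \<eta> x1 idx g x"
    and t: "t \<in> {1..T + 1}"
  shows "\<exists>B. \<forall>\<omega>\<in>space M. \<forall>\<omega>'\<in>space M. vnorm d (vdiff (x t \<omega>) (x t \<omega>')) \<le> B"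
  using t
proof (induction t)
  case 0
  then show ?case by simp
next
  case (Suc t)
  show ?case
  proof (cases "t = 0")
    case True
    then have "vnorm d (vdiff (x (Suc t) \<omega>) (x (Suc t) \<omega>')) \<le> 0"
      if "\<omega> \<in> space M" "\<omega>' \<in> space M" for \<omega> \<omega>'
      using run_basic(7)[OF run that(1)] run_basic(7)[OF run that(2)] True
      by (simp add: vnorm_def vinner_def vdiff_def)
    then show ?thesis by blast
  next
    case False
    then have t: "t \<in> {1..T}" "t \<in> {1..T + 1}" using Suc.prems by auto
    then obtain B where B: "\<And>\<omega> \<omega>'. \<omega> \<in> space M \<Longrightarrow> \<omega>' \<in> space M \<Longrightarrow> vnorm d (vdiff (x t \<omega>) (x t \<omega>')) \<le> B"
      using Suc.IH by blast
    have pr: "proper_fun d \<psi>" and cv: "convex_fun d \<psi>" and G: "\<And>i. i \<in> {1..n} \<Longrightarrow> 0 < G i"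
      using cp by (auto simp: composite_problem_def)
    have \<eta>: "0 < \<eta> t" by (rule run_basic(4)[OF run t(1)])
    define K where "K = (\<Sum>i=1..n. G i)"
    have step: "prox_step d \<psi> (\<eta> t) (g t \<omega>) (x t \<omega>) (x (Suc t) \<omega>)" "x t \<omega> \<in> Rd d" "g t \<omega> \<in> Rd d"
      "vnorm d (g t \<omega>) \<le> K" if w: "\<omega> \<in> space M" for \<omega>
    proof -
      note r = run_step[OF run w t(1)]
      have "G (idx t \<omega>) \<le> K"
        unfolding K_def using r(1) G by (intro member_le_sum) (simp_all add: less_imp_le)
      then show "vnorm d (g t \<omega>) \<le> K" using r(3) by simp
      show "prox_step d \<psi> (\<eta> t) (g t \<omega>) (x t \<omega>) (x (Suc t) \<omega>)" using r(4) by simp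
      show "g t \<omega> \<in> Rd d" using r(2) by (simp add: subdifferential_def)
      show "x t \<omega> \<in> Rd d" using run_in_dom[OF cp run w t(2)] by (rule eff_dom_in_Rd)
    qed
    have "vnorm d (vdiff (x (Suc t) \<omega>) (x (Suc t) \<omega>')) \<le> B + \<eta> t * (K + K)"
      if w: "\<omega> \<in> space M" "\<omega>' \<in> space M" for \<omega> \<omega>'
    proof -
      have "vnorm d (vdiff (x (Suc t) \<omega>) (x (Suc t) \<omega>'))
          \<le> vnorm d (vdiff (x t \<omega>) (x t \<omega>')) + \<eta> t * (vnorm d (g t \<omega>) + vnorm d (g t \<omega>'))"
        by (rule prox_step_nonexpansive[OF pr cv \<eta>]) (use step w in auto)
      also have "\<dots> \<le> B + \<eta> t * (K + K)"
        using B[OF w] step(4)[OF w(1)] step(4)[OF w(2)] \<eta> by (intro add_mono mult_left_mono) auto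
      finally show ?thesis .
    qed
    then show ?thesis by blast
  qed
qed

text \<open>
  Boundedness comes from \<open>run_diameter\<close>. For measurability, \<open>f\<^sub>i\<close> is treated as a continuous function
  on the domain of \<open>\<psi>\<close>, where it is Lipschitz and where the iterates stay.
\<close>

lemma integrable_component:
  assumes cp: "composite_problem d n f \<psi> \<mu> G" and run: "prox_gradient_run M d n f \<psi> G T \<eta> x1 idx g x"
    and t: "t \<in> {1..T + 1}" and i: "i \<in> {1..n}"
  shows "integrable M (\<lambda>\<omega>. f i (x t \<omega>))"
proof -
  interpret prob_space M by (rule run_basic(1)[OF run])
  have lip: "\<bar>f i u - f i v\<bar> \<le> G i * vnorm d (vdiff u v)" if "u \<in> eff_dom d \<psi>" "v \<in> eff_dom d \<psi>" for u v
    using cp i that by (auto simp: composite_problem_def)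
  have G: "0 < G i" using cp i by (auto simp: composite_problem_def)
  have "continuous_on (eff_dom d \<psi>) (f i)"
    unfolding continuous_on_def
  proof
    fix u assume u: "u \<in> eff_dom d \<psi>"
    have "((\<lambda>v. vnorm d (vdiff v u)) \<longlongrightarrow> vnorm d (vdiff u u)) (at u within eff_dom d \<psi>)"
      using continuous_on_vnorm_diff[of "eff_dom d \<psi>" d u] u by (simp add: continuous_on_def)
    moreover have "vnorm d (vdiff u u) = 0" by (simp add: vnorm_def vinner_def vdiff_def)
    ultimately have "((\<lambda>v. vnorm d (vdiff v u) * G i) \<longlongrightarrow> 0) (at u within eff_dom d \<psi>)"
      by (simp add: tendsto_mult_left_zero)
    moreover have "\<forall>\<^sub>F v in at u within eff_dom d \<psi>. norm (f i v - f i u) \<le> vnorm d (vdiff v u) * G i"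
      using lip u by (auto simp: eventually_at_filter mult.commute)
    ultimately have "((\<lambda>v. f i v - f i u) \<longlongrightarrow> 0) (at u within eff_dom d \<psi>)"
      by (rule Lim_null_comparison[rotated])
    then show "(f i \<longlongrightarrow> f i u) (at u within eff_dom d \<psi>)" by (simp add: LIM_zero_iff)
  qed
  then have "f i \<in> borel_measurable (restrict_space borel (eff_dom d \<psi>))"
    by (rule borel_measurable_continuous_on_restrict)
  moreover have "x t \<in> M \<rightarrow>\<^sub>M restrict_space borel (eff_dom d \<psi>)"
    using run_basic(6)[OF run t] run_in_dom[OF cp run _ t] by (intro measurable_restrict_space2) auto
  ultimately have meas: "(\<lambda>\<omega>. f i (x t \<omega>)) \<in> borel_measurable M"
    using measurable_compose by blast
  obtain \<omega>' where \<omega>': "\<omega>' \<in> space M" using not_empty by blast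
  obtain B where B: "\<And>\<omega>. \<omega> \<in> space M \<Longrightarrow> vnorm d (vdiff (x t \<omega>) (x t \<omega>')) \<le> B"
    using run_diameter[OF cp run t] \<omega>' by blast
  have "norm (f i (x t \<omega>)) \<le> \<bar>f i (x t \<omega>')\<bar> + G i * B" if w: "\<omega> \<in> space M" for \<omega>
  proof -
    have "G i * vnorm d (vdiff (x t \<omega>) (x t \<omega>')) \<le> G i * B"
      using B[OF w] G by (intro mult_left_mono) auto
    then show ?thesis
      using lip[OF run_in_dom[OF cp run w t] run_in_dom[OF cp run \<omega>' t]] by (simp only: real_norm_def)
  qed
  then show ?thesis using meas by (intro integrable_const_bound) auto
qed

lemma integrable_favg:
  assumes "composite_problem d n f \<psi> \<mu> G" "prox_gradient_run M d n f \<psi> G T \<eta> x1 idx g x"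
    "t \<in> {1..T + 1}"
  shows "integrable M (\<lambda>\<omega>. favg n f (x t \<omega>))"
  unfolding favg_def
  using integrable_component[OF assms] by (intro integrable_divide Bochner_Integration.integrable_sum) auto

lemma integrable_sampled:
  assumes cp: "composite_problem d n f \<psi> \<mu> G" and run: "prox_gradient_run M d n f \<psi> G T \<eta> x1 idx g x"
    and t: "t \<in> {1..T}" and s: "s \<in> {1..T + 1}"
  shows "integrable M (\<lambda>\<omega>. f (idx t \<omega>) (x s \<omega>))"
proof -
  let ?A = "\<lambda>i. {\<omega> \<in> space M. idx t \<omega> = i}"
  have "?A i \<in> sets M" if "i \<in> {1..n}" for i
  proof -
    from measurable_sets[OF run_basic(5)[OF run t], of "{i}"] that show ?thesis
      by (simp add: vimage_def Int_def conj_commute)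
  qed
  then have "integrable M (\<lambda>\<omega>. \<Sum>i=1..n. f i (x s \<omega>) * indicator (?A i) \<omega>)"
    using integrable_component[OF cp run s]
    by (intro Bochner_Integration.integrable_sum integrable_real_mult_indicator) auto
  moreover have "(\<Sum>i=1..n. f i (x s \<omega>) * indicator (?A i) \<omega>) = f (idx t \<omega>) (x s \<omega>)"
    if w: "\<omega> \<in> space M" for \<omega>
  proof -
    have "(\<Sum>i=1..n. f i (x s \<omega>) * indicator (?A i) \<omega>)
        = (\<Sum>i=1..n. if i = idx t \<omega> then f i (x s \<omega>) else 0)"
      using w by (intro sum.cong) (auto simp: indicator_def)
    then show ?thesis using run_step(1)[OF run w t] by simp
  qed
  ultimately show ?thesis by (simp cong: Bochner_Integration.integrable_cong)
qed

lemma expectation_uniform_index: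
  fixes h :: "nat \<Rightarrow> real"
  assumes meas: "j \<in> M \<rightarrow>\<^sub>M count_space {1..n}"
    and unif: "distr M (count_space {1..n}) j = uniform_count_measure {1..n}"
  shows "has_bochner_integral M (\<lambda>\<omega>. h (j \<omega>)) ((\<Sum>i=1..n. h i) / n)"
proof -
  have h: "h \<in> borel_measurable (count_space {1..n})" by simp
  have "integrable (uniform_count_measure {1..n}) h"
    by (simp add: uniform_count_measure_def integrable_point_measure_finite)
  then have "integrable M (\<lambda>\<omega>. h (j \<omega>))"
    unfolding unif[symmetric] integrable_distr_eq[OF meas h] .
  moreover have "(\<integral>\<omega>. h (j \<omega>) \<partial>M) = (\<Sum>i=1..n. h i) / n"
    using integral_distr[OF meas h] unfolding unif by (simp add: integral_uniform_count_measure)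
  ultimately show ?thesis by (simp add: has_bochner_integral_iff)
qed

text \<open>
  Both nonnegative integrals in the definition are monotone on arbitrary functions, measurable or not.
\<close>

lemma ereal_expectation_le_integral:
  assumes le: "\<And>\<omega>. \<omega> \<in> space M \<Longrightarrow> X \<omega> \<le> ereal (Y \<omega>)" and Y: "integrable M Y"
  shows "ereal_expectation M X \<le> ereal (\<integral>\<omega>. Y \<omega> \<partial>M)"
proof -
  have "(\<integral>\<^sup>+\<omega>. e2ennreal (X \<omega>) \<partial>M) \<le> (\<integral>\<^sup>+\<omega>. ennreal (Y \<omega>) \<partial>M)"
  proof (rule nn_integral_mono)
    fix \<omega> assume "\<omega> \<in> space M"
    from e2ennreal_mono[OF le[OF this]] show "e2ennreal (X \<omega>) \<le> ennreal (Y \<omega>)" by simp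
  qed
  moreover have "(\<integral>\<^sup>+\<omega>. ennreal (- Y \<omega>) \<partial>M) \<le> (\<integral>\<^sup>+\<omega>. e2ennreal (- X \<omega>) \<partial>M)"
  proof (rule nn_integral_mono)
    fix \<omega> assume "\<omega> \<in> space M"
    from le[OF this] have "- ereal (Y \<omega>) \<le> - X \<omega>" by (simp only: ereal_minus_le_minus)
    from e2ennreal_mono[OF this] show "ennreal (- Y \<omega>) \<le> e2ennreal (- X \<omega>)" by simp
  qed
  ultimately have "ereal_expectation M X
      \<le> enn2ereal (\<integral>\<^sup>+\<omega>. ennreal (Y \<omega>) \<partial>M) - enn2ereal (\<integral>\<^sup>+\<omega>. ennreal (- Y \<omega>) \<partial>M)"
    unfolding ereal_expectation_def by (intro ereal_minus_mono) (auto simp: less_eq_ennreal.rep_eq)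
  also have "\<dots> = ereal (\<integral>\<omega>. Y \<omega> \<partial>M)"
  proof -
    have fin: "(\<integral>\<^sup>+\<omega>. ennreal (Y \<omega>) \<partial>M) \<noteq> \<top>" "(\<integral>\<^sup>+\<omega>. ennreal (- Y \<omega>) \<partial>M) \<noteq> \<top>"
      using Y by (auto simp: real_integrable_def)
    obtain b where b: "0 \<le> b" "(\<integral>\<^sup>+\<omega>. ennreal (Y \<omega>) \<partial>M) = ennreal b"
      using fin(1) by (cases "\<integral>\<^sup>+\<omega>. ennreal (Y \<omega>) \<partial>M") auto
    obtain c where c: "0 \<le> c" "(\<integral>\<^sup>+\<omega>. ennreal (- Y \<omega>) \<partial>M) = ennreal c"
      using fin(2) by (cases "\<integral>\<^sup>+\<omega>. ennreal (- Y \<omega>) \<partial>M") auto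
    show ?thesis
      unfolding real_lebesgue_integral_def[OF Y] b(2) c(2) using b(1) c(1) by (simp add: enn2ereal_ennreal)
  qed
  finally show ?thesis .
qed

lemma Fobj_eff_dom:
  assumes "composite_problem d n f \<psi> \<mu> G" "y \<in> eff_dom d \<psi>"
  shows "Fobj n f \<psi> y = ereal (favg n f y + real_of_ereal (\<psi> y))"
  using assms unfolding Fobj_def composite_problem_def proper_fun_def eff_dom_def
  by (cases "\<psi> y") auto

text \<open>
  Outside the domain the comparison value is \<open>\<infinity>\<close> while the iterates have finite values.
\<close>

lemma ereal_expectation_outside_dom:
  assumes cp: "composite_problem d n f \<psi> \<mu> G" and run: "prox_gradient_run M d n f \<psi> G T \<eta> x1 idx g x"
    and z: "z \<in> Rd d" "z \<notin> eff_dom d \<psi>"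
  shows "ereal_expectation M (\<lambda>\<omega>. Fobj n f \<psi> (x (T + 1) \<omega>) - Fobj n f \<psi> z) = - \<infinity>"
proof -
  interpret prob_space M by (rule run_basic(1)[OF run])
  have "Fobj n f \<psi> z = \<infinity>" using z by (simp add: Fobj_def eff_dom_def)
  then have X: "Fobj n f \<psi> (x (T + 1) \<omega>) - Fobj n f \<psi> z = - \<infinity>" if "\<omega> \<in> space M" for \<omega>
    using Fobj_eff_dom[OF cp run_in_dom[OF cp run that, of "T + 1"]] by simp
  have "(\<integral>\<^sup>+\<omega>. e2ennreal (Fobj n f \<psi> (x (T + 1) \<omega>) - Fobj n f \<psi> z) \<partial>M) = (\<integral>\<^sup>+\<omega>. 0 \<partial>M)"
    using X by (intro nn_integral_cong) (simp add: e2ennreal_neg)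
  moreover have "(\<integral>\<^sup>+\<omega>. e2ennreal (- (Fobj n f \<psi> (x (T + 1) \<omega>) - Fobj n f \<psi> z)) \<partial>M) = (\<integral>\<^sup>+\<omega>. \<top> \<partial>M)"
    using X by (intro nn_integral_cong) simp
  ultimately show ?thesis
    unfolding ereal_expectation_def by (simp add: emeasure_space_1 zero_ennreal.rep_eq)
qed

text \<open>
  The right-hand side of the pathwise bound is integrable, and its mean splits into the initial
  distance, the second moments of the Lipschitz constants and the sampling errors.
\<close>

lemma expected_last_iterate_bound:
  assumes cp: "composite_problem d n f \<psi> \<mu> G" and run: "prox_gradient_run M d n f \<psi> G T \<eta> x1 idx g x"
    and unif: "\<And>t. t \<in> {1..T} \<Longrightarrow> distr M (count_space {1..n}) (idx t) = uniform_count_measure {1..n}"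
    and noninc: "\<And>s t. s \<in> {1..T} \<Longrightarrow> t \<in> {s..T} \<Longrightarrow> \<eta> t \<le> \<eta> s"
    and \<Phi>: "0 \<le> \<Phi>"
    and bias: "\<And>t s. t \<in> {1..T} \<Longrightarrow> s \<in> {1..t} \<Longrightarrow>
       \<bar>\<integral>\<omega>. (f (idx t \<omega>) (x s \<omega>) - favg n f (x s \<omega>)) \<partial>M\<bar> \<le> \<Phi> * \<eta> s"
    and z: "z \<in> eff_dom d \<psi>"
  shows "ereal_expectation M (\<lambda>\<omega>. Fobj n f \<psi> (x (T + 1) \<omega>) - Fobj n f \<psi> z)
      \<le> ereal (2 *
           ((vnorm d (vdiff z x1))\<^sup>2 / (\<Sum>t=1..T. gam \<mu> \<eta> t * \<eta> t)
            + ((Gf2 n G)\<^sup>2 + \<Phi>) *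
              (\<Sum>t=1..T. gam \<mu> \<eta> t * (\<eta> t)\<^sup>2 / (\<Sum>s=t..T. gam \<mu> \<eta> s * \<eta> s))))"
proof -
  interpret prob_space M by (rule run_basic(1)[OF run])
  have T: "1 \<le> T" by (rule run_basic(2)[OF run])
  have \<eta>: "0 < \<eta> t" if "t \<in> {1..T}" for t by (rule run_basic(4)[OF run that])
  have \<mu>: "0 \<le> \<mu>" using cp by (simp add: composite_problem_def)
  have n: "1 \<le> n" using cp by (simp add: composite_problem_def)
  define a where "a = (\<lambda>t. gam \<mu> \<eta> t * \<eta> t)"
  define w where "w = tail_weight a T"
  define N where "N = (vnorm d (vdiff z x1))\<^sup>2"
  define \<Omega> where "\<Omega> = (\<lambda>t s \<omega>. f (idx t \<omega>) (x s \<omega>) - favg n f (x s \<omega>))"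
  define \<Omega>z where "\<Omega>z = (\<lambda>t \<omega>. f (idx t \<omega>) z - favg n f z)"
  define H where "H = (\<lambda>t \<omega>. (G (idx t \<omega>))\<^sup>2)"
  define e where "e = (\<lambda>t s. \<integral>\<omega>. \<Omega> t s \<omega> \<partial>M)"
  define Y where "Y = (\<lambda>\<omega>. w 0 / 2 * N
      + (\<Sum>t=1..T. a t * (w t * \<eta> t * ((Gf2 n G)\<^sup>2 + H t \<omega>)))
      + (\<Sum>t=1..T. a t * (w 0 * \<Omega>z t \<omega> + (\<Sum>s=1..t. (w s - w (s - 1)) * \<Omega> t s \<omega>) - w t * \<Omega> t t \<omega>)))"
  have a: "0 < a t" if "t \<in> {1..T}" for t
    unfolding a_def using that \<eta> gam_pos[of \<mu> T \<eta> t] \<mu> by simp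
  have w: "0 < w t" if "t \<le> T" for t
    unfolding w_def using tail_weight_pos[of T a t] a T that by simp
  have wm: "w (t - 1) \<le> w t" if "t \<le> T" for t
    unfolding w_def using tail_weight_mono[of T a "t - 1"] a T that by (cases t) auto
  have XY: "Fobj n f \<psi> (x (T + 1) \<omega>) - Fobj n f \<psi> z \<le> ereal (Y \<omega>)" if \<omega>: "\<omega> \<in> space M" for \<omega>
  proof -
    have x1: "x 1 \<omega> = x1" by (rule run_basic(7)[OF run \<omega>])
    have x1': "x 1 \<omega> \<in> eff_dom d \<psi>" unfolding x1 by (rule run_basic(3)[OF run])
    have "favg n f (x (T + 1) \<omega>) + real_of_ereal (\<psi> (x (T + 1) \<omega>)) - (favg n f z + real_of_ereal (\<psi> z)) \<le> Y \<omega>"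
      using pathwise_last_iterate_bound[where x = "\<lambda>t. x t \<omega>" and j = "\<lambda>t. idx t \<omega>"
          and g = "\<lambda>t. g t \<omega>" and \<eta> = \<eta> and T = T and z = z,
          OF cp T \<eta> run_step(1)[OF run \<omega>] x1' run_step(2,3,4)[OF run \<omega>] z]
      unfolding Y_def H_def \<Omega>_def \<Omega>z_def w_def a_def N_def x1 .
    then show ?thesis
      unfolding Fobj_eff_dom[OF cp z] using Fobj_eff_dom[OF cp run_in_dom[OF cp run \<omega>, of "T + 1"]] by simp
  qed
  have const: "has_bochner_integral M (\<lambda>\<omega>. c) c" for c :: real
    by (simp add: has_bochner_integral_iff prob_space)
  have H: "has_bochner_integral M (H t) ((Gf2 n G)\<^sup>2)" if t: "t \<in> {1..T}" for t
    using expectation_uniform_index[OF run_basic(5)[OF run t] unif[OF t], of "\<lambda>i. (G i)\<^sup>2"]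
    by (simp add: H_def Gf2_def sum_nonneg)
  have \<Omega>z: "has_bochner_integral M (\<Omega>z t) 0" if t: "t \<in> {1..T}" for t
    using expectation_uniform_index[OF run_basic(5)[OF run t] unif[OF t], of "\<lambda>i. f i z - favg n f z"] n
    by (simp add: \<Omega>z_def favg_def sum_subtractf)
  have \<Omega>: "has_bochner_integral M (\<Omega> t s) (e t s)" if t: "t \<in> {1..T}" "s \<in> {1..t}" for t s
    unfolding e_def \<Omega>_def
    using integrable_sampled[OF cp run t(1), of s] integrable_favg[OF cp run, of s] t
    by (intro has_bochner_integral_integrable Bochner_Integration.integrable_diff) auto
  have Y: "has_bochner_integral M Y (w 0 / 2 * N
      + (\<Sum>t=1..T. a t * (w t * \<eta> t * ((Gf2 n G)\<^sup>2 + (Gf2 n G)\<^sup>2)))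
      + (\<Sum>t=1..T. a t * (w 0 * 0 + (\<Sum>s=1..t. (w s - w (s - 1)) * e t s) - w t * e t t)))"
    unfolding Y_def
    by (intro has_bochner_integral_add has_bochner_integral_diff has_bochner_integral_sum
        has_bochner_integral_mult_right const H \<Omega>z \<Omega>) auto
  define V where "V = (\<Sum>t=1..T. a t * w t * \<eta> t)"
  have e: "\<bar>e t s\<bar> \<le> \<Phi> * \<eta> s" if "t \<in> {1..T}" "s \<in> {1..t}" for t s
    using bias[OF that] by (simp add: e_def \<Omega>_def)
  \<comment> \<open>The increments of \<open>w\<close> are nonnegative, so the bounds on the sampling errors can be inserted. The
    summation identity returns them with \<open>\<eta>\<close> shifted by one step, hence the monotone stepsizes.\<close>
  have "(\<Sum>t=1..T. a t * (w 0 * 0 + (\<Sum>s=1..t. (w s - w (s - 1)) * e t s) - w t * e t t))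
      \<le> (\<Sum>t=1..T. a t * ((\<Sum>s=1..t. (w s - w (s - 1)) * (\<Phi> * \<eta> s)) + w t * (\<Phi> * \<eta> t)))"
  proof (intro sum_mono mult_left_mono)
    fix t assume t: "t \<in> {1..T}"
    have "(\<Sum>s=1..t. (w s - w (s - 1)) * e t s) \<le> (\<Sum>s=1..t. (w s - w (s - 1)) * (\<Phi> * \<eta> s))"
    proof (intro sum_mono mult_left_mono)
      fix s assume s: "s \<in> {1..t}"
      show "e t s \<le> \<Phi> * \<eta> s" using e[OF t s] by simp
      show "0 \<le> w s - w (s - 1)" using wm[of s] s t by simp
    qed
    moreover have "w t * - e t t \<le> w t * (\<Phi> * \<eta> t)"
      using e[of t t] t w[of t] by (intro mult_left_mono) auto
    ultimately show "w 0 * 0 + (\<Sum>s=1..t. (w s - w (s - 1)) * e t s) - w t * e t t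
        \<le> (\<Sum>s=1..t. (w s - w (s - 1)) * (\<Phi> * \<eta> s)) + w t * (\<Phi> * \<eta> t)"
      by simp
    show "0 \<le> a t" using a[OF t] by simp
  qed
  also have "\<dots> = (\<Sum>t=1..<T. a t * w t * (\<Phi> * \<eta> (Suc t))) + \<Phi> * V"
  proof -
    have "(\<Sum>t=1..T. a t * (\<Sum>s=1..t. (w s - w (s - 1)) * (\<Phi> * \<eta> s)))
        = (\<Sum>t=1..<T. a t * w t * (\<Phi> * \<eta> (Suc t)))"
      unfolding w_def using tail_weight_summation[of T a "\<lambda>s. \<Phi> * \<eta> s"] a T by simp
    moreover have "(\<Sum>t=1..T. a t * (w t * (\<Phi> * \<eta> t))) = \<Phi> * V"
      unfolding V_def sum_distrib_left by (intro sum.cong) (auto simp: algebra_simps)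
    ultimately show ?thesis by (simp only: distrib_left sum.distrib)
  qed
  also have "(\<Sum>t=1..<T. a t * w t * (\<Phi> * \<eta> (Suc t))) \<le> (\<Sum>t=1..<T. a t * w t * (\<Phi> * \<eta> t))"
  proof (intro sum_mono mult_left_mono)
    fix t assume t: "t \<in> {1..<T}"
    then show "\<eta> (Suc t) \<le> \<eta> t" using noninc[of t "Suc t"] by simp
    show "0 \<le> a t * w t" using a[of t] w[of t] t by simp
  qed (rule \<Phi>)
  also have "\<dots> \<le> (\<Sum>t=1..T. a t * w t * (\<Phi> * \<eta> t))"
  proof (rule sum_mono2)
    fix t assume "t \<in> {1..T} - {1..<T}"
    then have t: "t \<in> {1..T}" by simp
    then show "0 \<le> a t * w t * (\<Phi> * \<eta> t)" using a[OF t] w[of t] \<eta>[OF t] \<Phi> by simp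
  qed auto
  also have "\<dots> = \<Phi> * V"
    unfolding V_def sum_distrib_left by (intro sum.cong) (auto simp: algebra_simps)
  finally have err: "(\<Sum>t=1..T. a t * (w 0 * 0 + (\<Sum>s=1..t. (w s - w (s - 1)) * e t s) - w t * e t t))
      \<le> 2 * (\<Phi> * V)" by linarith
  have var: "(\<Sum>t=1..T. a t * (w t * \<eta> t * ((Gf2 n G)\<^sup>2 + (Gf2 n G)\<^sup>2))) = 2 * ((Gf2 n G)\<^sup>2 * V)"
    unfolding V_def sum_distrib_left by (intro sum.cong) (auto simp: algebra_simps)
  have "0 \<le> w 0 * N" using w[of 0] by (simp add: N_def)
  then have "(\<integral>\<omega>. Y \<omega> \<partial>M) \<le> 2 * (w 0 * N + ((Gf2 n G)\<^sup>2 + \<Phi>) * V)"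
    unfolding has_bochner_integral_integral_eq[OF Y] var using err by (simp add: algebra_simps)
  then have "ereal (\<integral>\<omega>. Y \<omega> \<partial>M) \<le> ereal (2 * (w 0 * N + ((Gf2 n G)\<^sup>2 + \<Phi>) * V))" by simp
  moreover have "V = (\<Sum>t=1..T. gam \<mu> \<eta> t * (\<eta> t)\<^sup>2 / (\<Sum>s=t..T. gam \<mu> \<eta> s * \<eta> s))"
    unfolding V_def w_def tail_weight_def a_def
    by (intro sum.cong) (auto simp: power2_eq_square max_absorb2)
  moreover have "w 0 * N = (vnorm d (vdiff z x1))\<^sup>2 / (\<Sum>t=1..T. gam \<mu> \<eta> t * \<eta> t)"
    by (simp add: w_def tail_weight_def a_def N_def)
  moreover have "ereal_expectation M (\<lambda>\<omega>. Fobj n f \<psi> (x (T + 1) \<omega>) - Fobj n f \<psi> z) \<le> ereal (\<integral>\<omega>. Y \<omega> \<partial>M)"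
    using XY Y by (intro ereal_expectation_le_integral) (auto simp: has_bochner_integral_iff)
  ultimately show ?thesis by (simp only:)
qed

theorem lemmaB2:
  shows "\<exists>C>0::real. \<forall>d n f \<psi> \<mu> G (M :: 'w measure) T \<eta> x1 idx g x \<Phi> z.
    composite_problem d n f \<psi> \<mu> G \<longrightarrow>
    prox_gradient_run M d n f \<psi> G T \<eta> x1 idx g x \<longrightarrow>
    (\<forall>t\<in>{1..T}. distr M (count_space {1..n}) (idx t) = uniform_count_measure {1..n}) \<longrightarrow>
    (\<forall>s\<in>{1..T}. \<forall>t\<in>{s..T}. \<eta> t \<le> \<eta> s) \<longrightarrow>
    0 \<le> \<Phi> \<longrightarrow>
    (\<forall>t\<in>{1..T}. \<forall>s\<in>{1..t}.
       \<bar>\<integral>\<omega>. (f (idx t \<omega>) (x s \<omega>) - favg n f (x s \<omega>)) \<partial>M\<bar> \<le> \<Phi> * \<eta> s) \<longrightarrow>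
    z \<in> Rd d \<longrightarrow>
    ereal_expectation M (\<lambda>\<omega>. Fobj n f \<psi> (x (T + 1) \<omega>) - Fobj n f \<psi> z)
      \<le> ereal (C *
           ((vnorm d (vdiff z x1))\<^sup>2 / (\<Sum>t=1..T. gam \<mu> \<eta> t * \<eta> t)
            + ((Gf2 n G)\<^sup>2 + \<Phi>) *
              (\<Sum>t=1..T. gam \<mu> \<eta> t * (\<eta> t)\<^sup>2 / (\<Sum>s=t..T. gam \<mu> \<eta> s * \<eta> s))))"
proof (intro exI[of _ 2] conjI allI impI)
  fix d n f \<psi> \<mu> G and M :: "'w measure" and T \<eta> x1 idx g x \<Phi> z
  assume cp: "composite_problem d n f \<psi> \<mu> G"
    and run: "prox_gradient_run M d n f \<psi> G T \<eta> x1 idx g x"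
    and unif: "\<forall>t\<in>{1..T}. distr M (count_space {1..n}) (idx t) = uniform_count_measure {1..n}"
    and noninc: "\<forall>s\<in>{1..T}. \<forall>t\<in>{s..T}. \<eta> t \<le> \<eta> s"
    and \<Phi>: "0 \<le> \<Phi>"
    and bias: "\<forall>t\<in>{1..T}. \<forall>s\<in>{1..t}.
       \<bar>\<integral>\<omega>. (f (idx t \<omega>) (x s \<omega>) - favg n f (x s \<omega>)) \<partial>M\<bar> \<le> \<Phi> * \<eta> s"
    and z: "z \<in> Rd d"
  let ?E = "ereal_expectation M (\<lambda>\<omega>. Fobj n f \<psi> (x (T + 1) \<omega>) - Fobj n f \<psi> z)"
  show "?E \<le> ereal (2 *
           ((vnorm d (vdiff z x1))\<^sup>2 / (\<Sum>t=1..T. gam \<mu> \<eta> t * \<eta> t)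
            + ((Gf2 n G)\<^sup>2 + \<Phi>) *
              (\<Sum>t=1..T. gam \<mu> \<eta> t * (\<eta> t)\<^sup>2 / (\<Sum>s=t..T. gam \<mu> \<eta> s * \<eta> s))))"
  proof (cases "z \<in> eff_dom d \<psi>")
    case True
    show ?thesis
      by (rule expected_last_iterate_bound[OF cp run bspec[OF unif] bspec[OF bspec[OF noninc]] \<Phi>
            bspec[OF bspec[OF bias]] True])
  next
    case False
    then show ?thesis using ereal_expectation_outside_dom[OF cp run z] by simp
  qed
qed simp

end
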